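(* Let $(\mathbf{X}_k)_{k\in\mathbb{N}}$ be an i.i.d. sequence of random elements of $\mathbb{M}$ that are not almost surely equal to $\mathcal{E}$. Then no subsequence of the sequence $\left(\frac1n(\mathbf{X}_0\boxplus\mathbf{X}_1\boxplus\cdots\boxplus\mathbf{X}_{n-1})\right)_{n\ge1}$ converges in distribution in $\mathbb{M}$.
   Context: $\mathbb{N}=\{0,1,2,\ldots\}$. A metric measure space is a triple $\mathcal{X}=(X,r_X,\mu_X)$ where $(X,r_X)$ is a complete separable metric space and $\mu_X$ is a Borel probability measure on $X$ with full support. Two such spaces are equivalent if there is an isometry from one onto the other that maps the first probability measure to the second by push-forward. $\mathbb{M}$ denotes the set of equivalence classes, and a class is not distinguished from its representatives. $\mathcal{E}\in\mathbb{M}$ is the class of one-point spaces. For $\mathcal{Y},\mathcal{Z}\in\mathbb{M}$, $\mathcal{Y}\boxplus\mathcal{Z}:=(Y\times Z,\,r_Y\oplus r_Z,\,\mu_Y\otimes\mu_Z)$ with $(r_Y\oplus r_Z)((y',z'),(y'',z''))=r_Y(y',y'')+r_Z(z',z'')$. For $a>0$, $a\mathcal{X}:=(X,a\,r_X,\mu_X)$. $\mathbb{M}$ carries the topology of the Gromov–Prohorov metric $d_{\mathrm{GPr}}(\mathcal{X},\mathcal{Y}):=\inf d_{\mathrm{Pr}}^{(Z,r_Z)}(\mu_X\circ\phi_X^{-1},\mu_Y\circ\phi_Y^{-1})$, where the infimum is over all metric spaces $(Z,r_Z)$ and isometric embeddings $\phi_X:X\to Z$, $\phi_Y:Y\to Z$,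 and $d_{\mathrm{Pr}}^{(Z,r_Z)}$ is the Prohorov metric on probability measures on $(Z,r_Z)$; $(\mathbb{M},d_{\mathrm{GPr}})$ is a complete separable metric space. Random elements of $\mathbb{M}$ are with respect to its Borel $\sigma$-algebra. *)

theory Defs
  imports "HOL-Probability.Probability"
begin

definition metric_borel :: "'a metric \<Rightarrow> 'a measure" where
  "metric_borel m = sigma (mspace m) {U. openin (mtopology_of m) U}"

type_synonym 'a mm = "'a metric \<times> 'a measure"

definition mm_space :: "'a mm \<Rightarrow> bool" where
  "mm_space = (\<lambda>(X, \<mu>).
     mcomplete_of X \<and> separable_space (mtopology_of X) \<and>
     prob_space \<mu> \<and> space \<mu> = mspace X \<and> sets \<mu> = sets (metric_borel X) \<and>
     (\<forall>U. openin (mtopology_of X) U \<and> U \<noteq> {} \<longrightarrow> 0 < measure \<mu> U))"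

definition isometric_embedding :: "'a metric \<Rightarrow> 'b metric \<Rightarrow> ('a \<Rightarrow> 'b) \<Rightarrow> bool" where
  "isometric_embedding X Y f \<longleftrightarrow>
     f \<in> mspace X \<rightarrow> mspace Y \<and>
     (\<forall>x\<in>mspace X. \<forall>x'\<in>mspace X. mdist Y (f x) (f x') = mdist X x x')"

definition mm_equiv :: "'a mm \<Rightarrow> 'b mm \<Rightarrow> bool" where
  "mm_equiv = (\<lambda>(X, \<mu>) (Y, \<nu>). mm_space (X, \<mu>) \<and> mm_space (Y, \<nu>) \<and>
     (\<exists>f. isometric_embedding X Y f \<and> f ` mspace X = mspace Y \<and>
          distr \<mu> (metric_borel Y) f = \<nu>))"

definition one_point_mm :: "'a \<Rightarrow> 'a mm" where
  "one_point_mm p = (metric ({p}, \<lambda>_ _. 0), return (count_space {p}) p)"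

lemma openin_subset_Pow: "{U. openin (mtopology_of X) U} \<subseteq> Pow (mspace X)"
  using openin_subset[of "mtopology_of X"] by auto

lemma space_metric_borel [simp]: "space (metric_borel X) = mspace X"
proof -
  have "{U. openin (mtopology_of X) U} \<subseteq> Pow (mspace X)"
    by (rule openin_subset_Pow)
  then show ?thesis by (simp add: metric_borel_def space_measure_of)
qed

lemma sets_metric_borel:
  "sets (metric_borel X) = sigma_sets (mspace X) {U. openin (mtopology_of X) U}"
proof -
  have "{U. openin (mtopology_of X) U} \<subseteq> Pow (mspace X)"
    by (rule openin_subset_Pow)
  then show ?thesis by (simp add: metric_borel_def)
qed

lemma isometric_embedding_measurable:
  assumes "isometric_embedding X Y f"
  shows "f \<in> metric_borel X \<rightarrow>\<^sub>M metric_borel Y"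
proof (unfold metric_borel_def[of Y], rule measurable_measure_of)
  show "{U. openin (mtopology_of Y) U} \<subseteq> Pow (mspace Y)"
    by (rule openin_subset_Pow)
  show "f \<in> space (metric_borel X) \<rightarrow> mspace Y"
    using assms by (simp add: isometric_embedding_def)
  fix U assume "U \<in> {U. openin (mtopology_of Y) U}"
  then have U: "openin (mtopology_of Y) U" by simp
  have "continuous_map (mtopology_of X) (mtopology_of Y) f"
    unfolding mtopology_of_def
  proof (subst Metric_space.metric_continuous_map[OF Metric_space_mspace_mdist Metric_space_mspace_mdist],
      intro conjI ballI allI impI)
    show "f ` mspace X \<subseteq> mspace Y"
      using assms by (auto simp: isometric_embedding_def)
    fix a and e :: real assume "a \<in> mspace X" "0 < e"
    then show "\<exists>d>0. \<forall>x. x \<in> mspace X \<and> mdist X a x < d \<longrightarrow> mdist Y (f a) (f x) < e"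
      using assms by (intro exI[of _ e]) (auto simp: isometric_embedding_def)
  qed
  then have "openin (mtopology_of X) {x \<in> mspace X. f x \<in> U}"
    using openin_continuous_map_preimage[OF _ U, of "mtopology_of X" f] by simp
  moreover have "f -` U \<inter> space (metric_borel X) = {x \<in> mspace X. f x \<in> U}"
    by auto
  ultimately show "f -` U \<inter> space (metric_borel X) \<in> sets (metric_borel X)"
    by (simp add: sets_metric_borel sigma_sets.Basic)
qed

lemma isometric_embedding_inj:
  assumes "isometric_embedding X Y f"
  shows "inj_on f (mspace X)"
proof (rule inj_onI)
  fix x x' assume x: "x \<in> mspace X" "x' \<in> mspace X" "f x = f x'"
  then have "f x \<in> mspace Y"
    using assms by (simp add: isometric_embedding_def Pi_iff)
  moreover have "mdist Y (f x) (f x') = mdist X x x'"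
    using assms x(1,2) by (simp add: isometric_embedding_def)
  ultimately have "mdist X x x' = 0" using x(3) mdist_zero[of "f x'" Y "f x'"] by simp
  then show "x = x'" using x by simp
qed

lemma mm_equiv_refl: "mm_space \<X> \<Longrightarrow> mm_equiv \<X> \<X>"
proof (cases \<X>)
  case (Pair X \<mu>)
  assume "mm_space \<X>"
  with Pair have "distr \<mu> (metric_borel X) (\<lambda>x. x) = \<mu>"
    by (intro distr_id2) (simp add: mm_space_def)
  with \<open>mm_space \<X>\<close> Pair show ?thesis
    by (auto simp: mm_equiv_def isometric_embedding_def intro!: exI[of _ "\<lambda>x. x"])
qed

lemma mm_equiv_sym: "mm_equiv \<X> \<Y> \<Longrightarrow> mm_equiv \<Y> \<X>"
proof (cases \<X>, cases \<Y>)
  fix X \<mu> Y \<nu> assume eq: "mm_equiv \<X> \<Y>" and [simp]: "\<X> = (X, \<mu>)" "\<Y> = (Y, \<nu>)"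
  then obtain f where mm: "mm_space (X, \<mu>)" "mm_space (Y, \<nu>)"
    and f: "isometric_embedding X Y f" "f ` mspace X = mspace Y" "distr \<mu> (metric_borel Y) f = \<nu>"
    by (auto simp: mm_equiv_def)
  define g where "g = inv_into (mspace X) f"
  have gf: "g (f x) = x" if "x \<in> mspace X" for x
    using that isometric_embedding_inj[OF f(1)] by (simp add: g_def)
  have g: "isometric_embedding Y X g" "g ` mspace Y = mspace X"
    using f(1) gf by (auto simp: isometric_embedding_def image_image simp flip: f(2))
  have sets: "sets \<mu> = sets (metric_borel X)" "space \<mu> = mspace X"
    using mm by (auto simp: mm_space_def)
  have "distr \<nu> (metric_borel X) g = distr \<mu> (metric_borel X) (g \<circ> f)"
    unfolding f(3)[symmetric] using sets f(1) g(1)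
    by (intro distr_distr) (auto simp: isometric_embedding_measurable cong: measurable_cong_sets)
  also have "\<dots> = distr \<mu> (metric_borel X) (\<lambda>x. x)"
    by (rule distr_cong) (auto simp: gf sets)
  also have "\<dots> = \<mu>" using sets by (intro distr_id2) simp
  finally show ?thesis using mm g by (auto simp: mm_equiv_def)
qed

lemma mm_equiv_trans:
  assumes "mm_equiv \<X> \<Y>" "mm_equiv \<Y> \<Z>"
  shows "mm_equiv \<X> \<Z>"
proof (cases \<X>, cases \<Y>, cases \<Z>)
  fix X \<mu> Y \<nu> Z \<kappa> assume [simp]: "\<X> = (X, \<mu>)" "\<Y> = (Y, \<nu>)" "\<Z> = (Z, \<kappa>)"
  obtain f g where mm: "mm_space (X, \<mu>)" "mm_space (Z, \<kappa>)"
    and f: "isometric_embedding X Y f" "f ` mspace X = mspace Y" "distr \<mu> (metric_borel Y) f = \<nu>"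
    and g: "isometric_embedding Y Z g" "g ` mspace Y = mspace Z" "distr \<nu> (metric_borel Z) g = \<kappa>"
    using assms by (auto simp: mm_equiv_def)
  have sets: "sets \<mu> = sets (metric_borel X)"
    using mm by (auto simp: mm_space_def)
  have "distr \<mu> (metric_borel Z) (g \<circ> f) = distr \<nu> (metric_borel Z) g"
    unfolding f(3)[symmetric] using sets f(1) g(1)
    by (intro distr_distr[symmetric])
       (auto simp: isometric_embedding_measurable cong: measurable_cong_sets)
  then have "distr \<mu> (metric_borel Z) (g \<circ> f) = \<kappa>" using g by simp
  moreover have "isometric_embedding X Z (g \<circ> f)"
    using f g by (auto simp: isometric_embedding_def Pi_def)
  moreover have "(g \<circ> f) ` mspace X = mspace Z"
    using f g by (metis image_comp)
  ultimately show ?thesis using mm unfolding mm_equiv_def by (auto simp del: o_apply)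
qed

lemma mm_space_one_point: "mm_space (one_point_mm p)"
proof -
  define d where "d = (\<lambda>(_::'a) (_::'a). 0::real)"
  interpret Metric_space "{p}" d
    by unfold_locales (auto simp: d_def)
  interpret prob_space "return (count_space {p}) p"
    by (rule prob_space_return) simp
  have "openin mtopology {p}" using openin_topspace[of mtopology] by simp
  then have *: "{U. openin mtopology U} = Pow {p}"
    using openin_subset[of mtopology] by (auto simp: subset_singleton_iff)
  have "mcomplete"
    unfolding mcomplete_def
  proof (intro allI impI)
    fix \<sigma> :: "nat \<Rightarrow> 'a" assume "MCauchy \<sigma>"
    then have "\<sigma> = (\<lambda>_. p)" by (auto simp: MCauchy_def)
    then show "\<exists>x. limitin mtopology \<sigma> x sequentially"
      by (intro exI[of _ p]) (simp add: limitin_def)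
  qed
  moreover have "separable_space mtopology"
    unfolding separable_space_def by (intro exI[of _ "{p}"]) (use closure_of_topspace[of mtopology] in auto)
  moreover have "sets (return (count_space {p}) p) = sets (metric_borel (metric ({p}, d)))"
    using sigma_algebra.sigma_sets_eq[OF sigma_algebra_Pow, of "{p}"]
    by (simp add: sets_metric_borel *)
  moreover have "0 < measure (return (count_space {p}) p) U" if "openin mtopology U" "U \<noteq> {}" for U
  proof -
    have "U = {p}" using that openin_subset[of mtopology U] by auto
    then show ?thesis using prob_space by simp
  qed
  ultimately show ?thesis
    using prob_space_axioms by (auto simp: mm_space_def one_point_mm_def simp flip: d_def)
qed

lemma mm_equiv_transport:
  assumes mm: "mm_space (X, \<mu>)" and f: "isometric_embedding X Y f" "f ` mspace X = mspace Y"
  shows "mm_equiv (X, \<mu>) (Y, distr \<mu> (metric_borel Y) f)"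
proof -
  define \<nu> where "\<nu> = distr \<mu> (metric_borel Y) f"
  interpret Metric_space12 "mspace X" "mdist X" "mspace Y" "mdist Y"
    by (rule Metric_space12_mspace_mdist)
  have iso: "mdist Y (f x) (f y) = mdist X x y" if "x \<in> mspace X" "y \<in> mspace X" for x y
    using f(1) that by (simp add: isometric_embedding_def)
  have hom: "homeomorphic_map (mtopology_of X) (mtopology_of Y) f"
    using isometry_imp_homeomorphic_map[OF f(2) iso] by (simp add: mtopology_of_def)
  have sets: "sets \<mu> = sets (metric_borel X)" "space \<mu> = mspace X" and p: "prob_space \<mu>"
    and complete: "M1.mcomplete"
    using mm by (auto simp: mm_space_def mcomplete_of_def)
  have meas: "f \<in> \<mu> \<rightarrow>\<^sub>M metric_borel Y"
    using isometric_embedding_measurable[OF f(1)] sets by (simp cong: measurable_cong_sets)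
  have "M2.mcomplete"
    unfolding M2.mcomplete_def
  proof (intro allI impI)
    fix \<sigma> assume \<sigma>: "M2.MCauchy \<sigma>"
    then have "\<forall>n. \<exists>x. x \<in> mspace X \<and> f x = \<sigma> n"
      using f(2) unfolding M2.MCauchy_def by (metis image_iff rangeI subsetD)
    then obtain \<tau> where \<tau>: "\<And>n. \<tau> n \<in> mspace X" "\<And>n. f (\<tau> n) = \<sigma> n"
      by metis
    have d: "mdist Y (\<sigma> m) (\<sigma> n) = mdist X (\<tau> m) (\<tau> n)" for m n
      using iso[OF \<tau>(1) \<tau>(1), of m n] by (simp add: \<tau>(2))
    have "M1.MCauchy \<tau>"
      using \<sigma> \<tau>(1) unfolding M1.MCauchy_def M2.MCauchy_def d by blast
    then obtain x where x: "limitin M1.mtopology \<tau> x sequentially"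
      using complete M1.mcomplete_def by blast
    then have "x \<in> mspace X" by (simp add: M1.limit_metric_sequentially)
    then have "mdist Y (\<sigma> n) (f x) = mdist X (\<tau> n) x" for n
      using iso[OF \<tau>(1), of x n] by (simp add: \<tau>(2))
    moreover have "\<sigma> n \<in> mspace Y" "f x \<in> mspace Y" for n
      using f(2) \<open>x \<in> mspace X\<close> \<tau>[of n] by (metis imageI)+
    ultimately have "limitin M2.mtopology \<sigma> (f x) sequentially"
      using x \<tau>(1) unfolding M1.limit_metric_sequentially M2.limit_metric_sequentially by simp
    then show "\<exists>y. limitin M2.mtopology \<sigma> y sequentially" ..
  qed
  moreover have "separable_space (mtopology_of Y)"
    using mm homeomorphic_separable_space[OF homeomorphic_map_imp_homeomorphic_space[OF hom]]
    by (simp add: mm_space_def)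
  moreover have "prob_space \<nu>"
    unfolding \<nu>_def by (rule prob_space.prob_space_distr[OF p meas])
  moreover have "0 < measure \<nu> U" if U: "openin (mtopology_of Y) U" "U \<noteq> {}" for U
  proof -
    have "U \<in> sets (metric_borel Y)" using U by (simp add: sets_metric_borel sigma_sets.Basic)
    then have "measure \<nu> U = measure \<mu> (f -` U \<inter> space \<mu>)"
      unfolding \<nu>_def by (rule measure_distr[OF meas])
    moreover have "f -` U \<inter> space \<mu> = {x \<in> topspace (mtopology_of X). f x \<in> U}"
      using sets by auto
    moreover have "openin (mtopology_of X) {x \<in> topspace (mtopology_of X). f x \<in> U}"
      using hom U(1) homeomorphic_imp_continuous_map openin_continuous_map_preimage by blast
    moreover have "{x \<in> topspace (mtopology_of X). f x \<in> U} \<noteq> {}"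
    proof -
      obtain y where "y \<in> U" using U(2) by blast
      then have "y \<in> f ` mspace X" using openin_subset[OF U(1)] f(2) by auto
      with \<open>y \<in> U\<close> show ?thesis by auto
    qed
    ultimately show ?thesis using mm by (simp add: mm_space_def)
  qed
  ultimately have "mm_space (Y, \<nu>)"
    by (auto simp: mm_space_def mcomplete_of_def \<nu>_def)
  with mm f show ?thesis unfolding mm_equiv_def \<nu>_def by auto
qed

lemma separable_metric_inj_real:
  assumes "separable_space (mtopology_of X)"
  shows "\<exists>h :: 'a \<Rightarrow> real. inj_on h (mspace (X :: 'a metric))"
proof -
  interpret Metric_space "mspace X" "mdist X" by simp
  obtain C where C: "countable C" "C \<subseteq> mspace X" "mtopology closure_of C = mspace X"
    using assms by (auto simp: separable_space_def mtopology_of_def)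
  define g where "g x = {n. case prod_decode n of (i, j) \<Rightarrow>
    from_nat_into C i \<in> C \<and> mdist X x (from_nat_into C i) < 1 / real (Suc j)}" for x
  have "inj_on g (mspace X)"
  proof (rule inj_onI, rule ccontr)
    fix x y assume xy: "x \<in> mspace X" "y \<in> mspace X" "g x = g y" "x \<noteq> y"
    then have "0 < mdist X x y / 2" by simp
    then obtain j where j: "1 / real (Suc j) < mdist X x y / 2"
      using nat_approx_posE by (metis of_nat_Suc)
    have "x \<in> mtopology closure_of C" using C xy by simp
    then obtain c where c: "c \<in> C" "mdist X x c < 1 / real (Suc j)"
    proof -
      have "0 < 1 / real (Suc j)" by simp
      then obtain c where "c \<in> C" "c \<in> mball x (1 / real (Suc j))"
        using \<open>x \<in> mtopology closure_of C\<close> unfolding metric_closure_of by blast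
      then show ?thesis using that by auto
    qed
    obtain i where i: "from_nat_into C i = c"
      using c(1) C(1) from_nat_into_surj by metis
    have "prod_encode (i, j) \<in> g x" using c i by (simp add: g_def)
    then have "prod_encode (i, j) \<in> g y" using xy by simp
    then have "mdist X y c < 1 / real (Suc j)" by (simp add: g_def i)
    moreover have "mdist X x y \<le> mdist X x c + mdist X y c"
      using triangle[of x c y] commute[of c y] xy c C by auto
    ultimately show False using c j by linarith
  qed
  moreover obtain e :: "nat set \<Rightarrow> real" where "inj e"
    using eqpoll_imp_lepoll[OF nat_sets_eqpoll_reals] by (auto simp: lepoll_def)
  ultimately have "inj_on (e \<circ> g) (mspace X)"
    by (intro comp_inj_on) (auto intro: inj_on_subset)
  then show ?thesis by blast
qed

lemma ex_real_mm:
  assumes "mm_space \<X>"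
  shows "\<exists>\<Y>::real mm. mm_equiv \<X> \<Y>"
proof (cases \<X>)
  case (Pair X \<mu>)
  with assms obtain h :: "'a \<Rightarrow> real" where h: "inj_on h (mspace X)"
    using separable_metric_inj_real by (fastforce simp: mm_space_def)
  define g where "g = inv_into (mspace X) h"
  have gh: "g (h x) = x" if "x \<in> mspace X" for x
    using that h by (simp add: g_def)
  interpret Metric_space "h ` mspace X" "\<lambda>a b. mdist X (g a) (g b)"
    by unfold_locales (auto simp: gh mdist_commute mdist_triangle)
  have "isometric_embedding X (metric (h ` mspace X, \<lambda>a b. mdist X (g a) (g b))) h"
    by (auto simp: isometric_embedding_def gh)
  from mm_equiv_transport[OF _ this, of \<mu>] assms Pair show ?thesis
    by auto
qed

text \<open>
  A separable metric space has at most continuum many points, so every metric measure space is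
  equivalent to one carried by a set of reals; hence classes of real-carried
  spaces represent all metric measure spaces (lemma ex_real_mm).
\<close>

quotient_type mmclass = "real mm" / partial: "mm_equiv :: real mm \<Rightarrow> real mm \<Rightarrow> bool"
proof (intro part_equivpI)
  show "\<exists>\<X>::real mm. mm_equiv \<X> \<X>"
    by (rule exI, rule mm_equiv_refl, rule mm_space_one_point)
  show "symp (mm_equiv :: real mm \<Rightarrow> _)"
    by (rule sympI) (rule mm_equiv_sym)
  show "transp (mm_equiv :: real mm \<Rightarrow> _)"
    by (rule transpI) (rule mm_equiv_trans)
qed

definition mm_class :: "'a mm \<Rightarrow> mmclass" where
  "mm_class \<X> = abs_mmclass (SOME \<Y>. mm_equiv \<X> \<Y>)"

definition mm_point :: mmclass where
  "mm_point = mm_class (one_point_mm ())"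

definition sum_metric :: "'a metric \<Rightarrow> 'b metric \<Rightarrow> ('a \<times> 'b) metric" where
  "sum_metric Y Z = metric (mspace Y \<times> mspace Z,
     \<lambda>(y', z') (y'', z''). mdist Y y' y'' + mdist Z z' z'')"

definition scale_metric :: "real \<Rightarrow> 'a metric \<Rightarrow> 'a metric" where
  "scale_metric a X = metric (mspace X, \<lambda>x y. a * mdist X x y)"

definition mm_plus :: "mmclass \<Rightarrow> mmclass \<Rightarrow> mmclass"  (infixl "\<boxplus>" 65) where
  "y \<boxplus> z = (case (rep_mmclass y, rep_mmclass z) of ((Y, \<mu>), (Z, \<nu>)) \<Rightarrow>
     mm_class (sum_metric Y Z, \<mu> \<Otimes>\<^sub>M \<nu>))"

definition mm_scale :: "real \<Rightarrow> mmclass \<Rightarrow> mmclass" where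
  "mm_scale a x = (case rep_mmclass x of (X, \<mu>) \<Rightarrow> mm_class (scale_metric a X, \<mu>))"

fun mm_partial_sum :: "(nat \<Rightarrow> mmclass) \<Rightarrow> nat \<Rightarrow> mmclass" where
  "mm_partial_sum x 0 = mm_point"
| "mm_partial_sum x (Suc 0) = x 0"
| "mm_partial_sum x (Suc (Suc n)) = mm_partial_sum x (Suc n) \<boxplus> x (Suc n)"

definition prohorov_dist :: "'a metric \<Rightarrow> 'a measure \<Rightarrow> 'a measure \<Rightarrow> real" where
  "prohorov_dist Z P Q = Inf {\<epsilon>. 0 < \<epsilon> \<and>
     (\<forall>F. closedin (mtopology_of Z) F \<longrightarrow>
        measure P F \<le> measure Q {z \<in> mspace Z. \<exists>w\<in>F. mdist Z z w < \<epsilon>} + \<epsilon>)}"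

text \<open>
  The ambient space may be restricted to the union of the two embedded images without changing the
  Prohorov distance, so ambient spaces carried by sets of reals suffice for the infimum over all
  metric spaces.
\<close>

definition gromov_prohorov :: "mmclass \<Rightarrow> mmclass \<Rightarrow> real" where
  "gromov_prohorov x y = (case (rep_mmclass x, rep_mmclass y) of ((X, \<mu>), (Y, \<nu>)) \<Rightarrow>
     Inf {prohorov_dist Z (distr \<mu> (metric_borel Z) \<phi>) (distr \<nu> (metric_borel Z) \<psi>)
          | (Z :: real metric) \<phi> \<psi>. isometric_embedding X Z \<phi> \<and> isometric_embedding Y Z \<psi>})"

instantiation mmclass :: topological_space
begin

definition open_mmclass :: "mmclass set \<Rightarrow> bool" where
  "open_mmclass U \<longleftrightarrow> (\<forall>x\<in>U. \<exists>\<epsilon>>0. \<forall>y. gromov_prohorov x y < \<epsilon> \<longrightarrow> y \<in> U)"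

instance
proof
  show "open (UNIV :: mmclass set)"
    by (auto simp: open_mmclass_def intro: exI[of _ 1])
next
  fix S T :: "mmclass set"
  assume S: "open S" and T: "open T"
  show "open (S \<inter> T)"
    unfolding open_mmclass_def
  proof
    fix x assume "x \<in> S \<inter> T"
    then obtain d e where "d > 0" "\<forall>y. gromov_prohorov x y < d \<longrightarrow> y \<in> S"
      "e > 0" "\<forall>y. gromov_prohorov x y < e \<longrightarrow> y \<in> T"
      using S T unfolding open_mmclass_def by blast
    then show "\<exists>\<epsilon>>0. \<forall>y. gromov_prohorov x y < \<epsilon> \<longrightarrow> y \<in> S \<inter> T"
      by (intro exI[of _ "min d e"]) auto
  qed
next
  fix K :: "mmclass set set"
  assume "\<forall>S\<in>K. open S"
  then show "open (\<Union>K)"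
    unfolding open_mmclass_def
  proof (intro ballI)
    fix x assume K: "\<forall>S\<in>K. \<forall>x\<in>S. \<exists>\<epsilon>>0. \<forall>y. gromov_prohorov x y < \<epsilon> \<longrightarrow> y \<in> S"
      and "x \<in> \<Union>K"
    then obtain S where "S \<in> K" "x \<in> S" by blast
    with K obtain e where "e > 0" "\<forall>y. gromov_prohorov x y < e \<longrightarrow> y \<in> S" by blast
    with \<open>S \<in> K\<close> show "\<exists>\<epsilon>>0. \<forall>y. gromov_prohorov x y < \<epsilon> \<longrightarrow> y \<in> \<Union>K"
      by blast
  qed
qed

end

text \<open>
  The limit enters only through its law \<open>\<nu>\<close>, a Borel probability measure.
\<close>

definition converges_in_distribution ::
  "'w measure \<Rightarrow> (nat \<Rightarrow> 'w \<Rightarrow> 'a::topological_space) \<Rightarrow> 'a measure \<Rightarrow> bool" where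
  "converges_in_distribution M S \<nu> \<longleftrightarrow>
     prob_space \<nu> \<and> sets \<nu> = sets borel \<and>
     (\<forall>f::'a \<Rightarrow> real. continuous_on UNIV f \<and> bounded (range f) \<longrightarrow>
        (\<lambda>n. \<integral>\<omega>. f (S n \<omega>) \<partial>M) \<longlonglongrightarrow> (\<integral>x. f x \<partial>\<nu>))"

end

theory Submission
  imports Defs "HOL-Real_Asymp.Real_Asymp"
begin

text \<open>
  For \<open>l \<ge> 0\<close> let \<open>\<Phi>\<^sub>l(x)\<close> be the Laplace transform at \<open>l\<close> of the distance of two independent random
  points of the metric measure space \<open>x\<close> (\<open>class_laplace\<close>). Three properties make it the right test
  function for normalized sums.

  \<^item> It is multiplicative, \<open>\<Phi>\<^sub>l(x \<boxplus> y) = \<Phi>\<^sub>l(x) \<Phi>\<^sub>l(y)\<close>, and \<open>\<Phi>\<^sub>l(a x) = \<Phi>\<^bsub>l a\<^esub>(x)\<close>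
    (\<open>class_laplace_plus\<close>, \<open>class_laplace_scale\<close>).
  \<^item> It is bounded and continuous for the Gromov-Prohorov topology (\<open>continuous_class_laplace\<close>).
  \<^item> For a fixed \<open>x\<close> it decays more slowly than every exponential as \<open>l\<close> grows, because in a space with
    full support two random points are arbitrarily close with positive probability
    (\<open>dist_laplace_lower\<close>).

  Let \<open>g(l)\<close> be the mean of \<open>\<Phi>\<^sub>l(X\<^sub>0)\<close>. Independence and multiplicativity give \<open>g(l / n)\<close> to the power \<open>n\<close>
  as the mean of \<open>\<Phi>\<^sub>l\<close> at the normalized sum of \<open>n\<close> terms. By convexity \<open>g(s) \<le> 1 - c s \<le> exp(- c s)\<close>
  for \<open>s\<close> in \<open>[0, 1]\<close>, where \<open>c = 1 - g(1)\<close> is positive since \<open>X\<^sub>0\<close> is not almost surely a point. So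
  along any subsequence the means are eventually at most \<open>exp(- c l)\<close>, and a limit law \<open>\<nu>\<close> satisfies
  \<open>\<integral> \<Phi>\<^sub>l d\<nu> \<le> exp(- c l)\<close> for all integers \<open>l\<close>. But \<open>exp(c l / 2) \<Phi>\<^sub>l(x)\<close> tends to infinity for every single
  \<open>x\<close>, so by dominated convergence the \<open>\<nu>\<close>-integral of its minimum with 1 tends to 1, while the
  bound forces it to 0.

  In probabilistic terms: a law of large numbers makes the distance of two random points of the
  normalized sum concentrate near a positive constant or diverge, and no separable space with full
  support has such a distance.
\<close>

section \<open>Metric spaces in terms of their distance\<close>

text \<open>
  Openness, separability and completeness are expressed through \<open>mdist\<close> alone, so that they can be
  read off from the explicit distances of \<open>sum_metric\<close> and \<open>scale_metric\<close>.
\<close>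

lemma openin_metric_iff:
  "openin (mtopology_of X) U \<longleftrightarrow>
     U \<subseteq> mspace X \<and> (\<forall>x\<in>U. \<exists>r>0. \<forall>y\<in>mspace X. mdist X x y < r \<longrightarrow> y \<in> U)"
proof -
  interpret Metric_space "mspace X" "mdist X" by simp
  show ?thesis
    by (simp add: mtopology_of_def openin_mtopology subset_eq Ball_def imp_conjL cong: conj_cong imp_cong)
qed

lemma separable_metric_iff:
  "separable_space (mtopology_of X) \<longleftrightarrow>
     (\<exists>C. countable C \<and> C \<subseteq> mspace X \<and> (\<forall>x\<in>mspace X. \<forall>r>0. \<exists>c\<in>C. mdist X x c < r))"
proof -
  interpret Metric_space "mspace X" "mdist X" by simp
  have "mtopology closure_of C = mspace X \<longleftrightarrow> (\<forall>x\<in>mspace X. \<forall>r>0. \<exists>c\<in>C. mdist X x c < r)"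
    if "C \<subseteq> mspace X" for C
    using that by (fastforce simp: metric_closure_of)
  then show ?thesis
    by (auto simp: separable_space_def mtopology_of_def)
qed

lemma complete_metric_iff:
  "mcomplete_of X \<longleftrightarrow>
     (\<forall>\<sigma>. range \<sigma> \<subseteq> mspace X \<and> (\<forall>\<epsilon>>0. \<exists>N. \<forall>n n'. N \<le> n \<longrightarrow> N \<le> n' \<longrightarrow> mdist X (\<sigma> n) (\<sigma> n') < \<epsilon>)
        \<longrightarrow> (\<exists>x\<in>mspace X. (\<lambda>n. mdist X (\<sigma> n) x) \<longlonglongrightarrow> 0))"
proof -
  interpret Metric_space "mspace X" "mdist X" by simp
  have "limitin mtopology \<sigma> x sequentially \<longleftrightarrow> x \<in> mspace X \<and> (\<lambda>n. mdist X (\<sigma> n) x) \<longlonglongrightarrow> 0"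
    if "range \<sigma> \<subseteq> mspace X" for \<sigma> x
    using that by (simp add: limit_metric_sequentially LIMSEQ_def image_subset_iff)
  then have "(range \<sigma> \<subseteq> mspace X \<and> P \<longrightarrow> (\<exists>x. limitin mtopology \<sigma> x sequentially)) \<longleftrightarrow>
      (range \<sigma> \<subseteq> mspace X \<and> P \<longrightarrow> (\<exists>x\<in>mspace X. (\<lambda>n. mdist X (\<sigma> n) x) \<longlonglongrightarrow> 0))" for \<sigma> P
    by auto
  then show ?thesis
    unfolding mcomplete_of_def mcomplete_def MCauchy_def by simp
qed

lemma openin_lipschitz_preimage:
  fixes f :: "'a \<Rightarrow> real"
  assumes L: "0 \<le> L"
    and f: "\<And>x y. x \<in> mspace X \<Longrightarrow> y \<in> mspace X \<Longrightarrow> \<bar>f x - f y\<bar> \<le> L * mdist X x y"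
    and S: "open S"
  shows "openin (mtopology_of X) {x \<in> mspace X. f x \<in> S}"
  unfolding openin_metric_iff
proof (intro conjI ballI)
  fix x assume x: "x \<in> {x \<in> mspace X. f x \<in> S}"
  then obtain e where e: "0 < e" "\<And>t. dist t (f x) < e \<Longrightarrow> t \<in> S"
    using S by (auto simp: open_dist)
  show "\<exists>r>0. \<forall>y\<in>mspace X. mdist X x y < r \<longrightarrow> y \<in> {x \<in> mspace X. f x \<in> S}"
  proof (intro exI[of _ "e / (L + 1)"] conjI ballI impI)
    show "0 < e / (L + 1)" using e L by simp
    fix y assume y: "y \<in> mspace X" "mdist X x y < e / (L + 1)"
    have "\<bar>f y - f x\<bar> \<le> L * mdist X x y" using f[of x y] x y by (simp add: abs_minus_commute)
    also have "\<dots> \<le> (L + 1) * mdist X x y" by (simp add: distrib_right)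
    also have "\<dots> < e" using y L by (simp add: field_simps)
    finally show "y \<in> {x \<in> mspace X. f x \<in> S}" using y e by (simp add: dist_real_def)
  qed
qed auto

lemma openin_sets_metric_borel: "openin (mtopology_of X) U \<Longrightarrow> U \<in> sets (metric_borel X)"
  by (simp add: sets_metric_borel sigma_sets.Basic)

lemma lipschitz_borel_measurable:
  fixes f :: "'a \<Rightarrow> real"
  assumes "0 \<le> L"
    and "\<And>x y. x \<in> mspace X \<Longrightarrow> y \<in> mspace X \<Longrightarrow> \<bar>f x - f y\<bar> \<le> L * mdist X x y"
  shows "f \<in> borel_measurable (metric_borel X)"
proof (rule borel_measurableI)
  fix S :: "real set" assume "open S"
  then show "f -` S \<inter> space (metric_borel X) \<in> sets (metric_borel X)"
    using openin_sets_metric_borel[OF openin_lipschitz_preimage[OF assms(1), of X f S]] assms(2)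
    by (simp add: vimage_def Int_def conj_commute)
qed

lemma nonexpansive_measurable:
  assumes f: "f \<in> mspace X \<rightarrow> mspace Y"
    and le: "\<And>x y. x \<in> mspace X \<Longrightarrow> y \<in> mspace X \<Longrightarrow> mdist Y (f x) (f y) \<le> mdist X x y"
  shows "f \<in> metric_borel X \<rightarrow>\<^sub>M metric_borel Y"
  unfolding metric_borel_def[of Y]
proof (rule measurable_measure_of)
  fix U assume "U \<in> {U. openin (mtopology_of Y) U}"
  then have U: "openin (mtopology_of Y) U" by simp
  have "openin (mtopology_of X) (f -` U \<inter> mspace X)"
    unfolding openin_metric_iff
  proof (intro conjI ballI)
    fix x assume x: "x \<in> f -` U \<inter> mspace X"
    then obtain r where r: "0 < r" "\<And>y. y \<in> mspace Y \<Longrightarrow> mdist Y (f x) y < r \<Longrightarrow> y \<in> U"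
      using U unfolding openin_metric_iff by auto
    have "f y \<in> U" if "y \<in> mspace X" "mdist X x y < r" for y
      using that x f le[of x y] by (intro r(2)) auto
    with r(1) show "\<exists>r>0. \<forall>y\<in>mspace X. mdist X x y < r \<longrightarrow> y \<in> f -` U \<inter> mspace X" by auto
  qed auto
  then show "f -` U \<inter> space (metric_borel X) \<in> sets (metric_borel X)"
    by (simp add: openin_sets_metric_borel)
qed (use f openin_subset_Pow in auto)

lemma mm_spaceD:
  assumes "mm_space (X, \<mu>)"
  shows "mcomplete_of X" "separable_space (mtopology_of X)" "prob_space \<mu>" "space \<mu> = mspace X"
    "sets \<mu> = sets (metric_borel X)"
    "\<And>U. openin (mtopology_of X) U \<Longrightarrow> U \<noteq> {} \<Longrightarrow> 0 < measure \<mu> U"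
  using assms by (auto simp: mm_space_def)

lemma openin_metric_ball: "openin (mtopology_of X) {y \<in> mspace X. mdist X x y < r}" if "x \<in> mspace X"
proof -
  interpret Metric_space "mspace X" "mdist X" by simp
  have "{y \<in> mspace X. mdist X x y < r} = mball x r" using that by auto
  then show ?thesis by (simp add: mtopology_of_def)
qed

lemma measure_ball_pos:
  assumes "mm_space (X, \<mu>)" "x \<in> mspace X" "0 < r"
  shows "0 < measure \<mu> {y \<in> mspace X. mdist X x y < r}"
  by (rule mm_spaceD(6)[OF assms(1) openin_metric_ball[OF assms(2)]]) (use assms in \<open>auto simp: mdist_zero[of x X x, THEN iffD2] intro!: exI[of _ x]\<close>)

section \<open>The sum and the scaling of metric measure spaces\<close>

lemma sum_metric_simps [simp]:
  "mspace (sum_metric Y Z) = mspace Y \<times> mspace Z"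
  "mdist (sum_metric Y Z) p q = mdist Y (fst p) (fst q) + mdist Z (snd p) (snd q)"
proof -
  interpret Metric_space "mspace Y \<times> mspace Z"
    "\<lambda>(y', z') (y'', z''). mdist Y y' y'' + mdist Z z' z''"
  proof unfold_locales
    fix p q r assume "p \<in> mspace Y \<times> mspace Z" "q \<in> mspace Y \<times> mspace Z" "r \<in> mspace Y \<times> mspace Z"
    then show "(case p of (y', z') \<Rightarrow> \<lambda>(y'', z''). mdist Y y' y'' + mdist Z z' z'') r
       \<le> (case p of (y', z') \<Rightarrow> \<lambda>(y'', z''). mdist Y y' y'' + mdist Z z' z'') q +
          (case q of (y', z') \<Rightarrow> \<lambda>(y'', z''). mdist Y y' y'' + mdist Z z' z'') r"
      using mdist_triangle[of "fst p" Y "fst q" "fst r"] mdist_triangle[of "snd p" Z "snd q" "snd r"]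
      by (auto split: prod.splits)
  qed (auto simp: mdist_commute add_nonneg_eq_0_iff)
  show "mspace (sum_metric Y Z) = mspace Y \<times> mspace Z"
    "mdist (sum_metric Y Z) p q = mdist Y (fst p) (fst q) + mdist Z (snd p) (snd q)"
    by (simp_all add: sum_metric_def split: prod.splits)
qed

lemma openin_sum_metric_ball_rectangle:
  assumes W: "openin (mtopology_of (sum_metric Y Z)) W" and p: "(y, z) \<in> W"
  obtains r where "0 < r"
    "\<And>y' z'. y' \<in> mspace Y \<Longrightarrow> z' \<in> mspace Z \<Longrightarrow> mdist Y y y' < r \<Longrightarrow> mdist Z z z' < r \<Longrightarrow> (y', z') \<in> W"
proof -
  obtain r where r: "0 < r"
    "\<And>q. q \<in> mspace Y \<times> mspace Z \<Longrightarrow> mdist (sum_metric Y Z) (y, z) q < r \<Longrightarrow> q \<in> W"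
    using W p unfolding openin_metric_iff by (metis sum_metric_simps(1))
  show ?thesis
    by (rule that[of "r / 2"]) (use r in auto)
qed

text \<open>
  Every open set of the sum metric contains, around each of its points, a product of two balls with
  centres in countable dense sets and radii \<open>1 / Suc n\<close>; separability thus makes it a countable union
  of measurable rectangles. Conversely both projections are nonexpansive, hence Borel.
\<close>

lemma sets_metric_borel_sum:
  assumes "separable_space (mtopology_of Y)" "separable_space (mtopology_of Z)"
  shows "sets (metric_borel (sum_metric Y Z)) = sets (metric_borel Y \<Otimes>\<^sub>M metric_borel Z)"
proof (rule antisym)
  obtain C where C: "countable C" "C \<subseteq> mspace Y" "\<And>x r. x \<in> mspace Y \<Longrightarrow> 0 < r \<Longrightarrow> \<exists>c\<in>C. mdist Y x c < r"
    using assms(1) unfolding separable_metric_iff by metis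
  obtain D where D: "countable D" "D \<subseteq> mspace Z" "\<And>x r. x \<in> mspace Z \<Longrightarrow> 0 < r \<Longrightarrow> \<exists>c\<in>D. mdist Z x c < r"
    using assms(2) unfolding separable_metric_iff by metis
  define R where "R = (\<lambda>(c, d, n::nat). {y \<in> mspace Y. mdist Y c y < 1 / Suc n} \<times> {z \<in> mspace Z. mdist Z d z < 1 / Suc n})"
  have "W \<in> sets (metric_borel Y \<Otimes>\<^sub>M metric_borel Z)"
    if W: "openin (mtopology_of (sum_metric Y Z)) W" for W
  proof -
    define I where "I = {i \<in> C \<times> D \<times> UNIV. R i \<subseteq> W}"
    have "W \<subseteq> (\<Union>i\<in>I. R i)"
    proof
      fix p assume pW: "p \<in> W"
      obtain y z where p: "p = (y, z)" by (cases p)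
      have yz: "y \<in> mspace Y" "z \<in> mspace Z"
        using W pW p openin_subset[OF W] by auto
      obtain r where r: "0 < r"
        "\<And>y' z'. y' \<in> mspace Y \<Longrightarrow> z' \<in> mspace Z \<Longrightarrow> mdist Y y y' < r \<Longrightarrow> mdist Z z z' < r \<Longrightarrow> (y', z') \<in> W"
        using openin_sum_metric_ball_rectangle[OF W, of y z] pW p by metis
      obtain n where n: "1 / real (Suc n) < r / 2"
        using nat_approx_posE[of "r / 2"] r by auto
      obtain c where c: "c \<in> C" "mdist Y y c < 1 / real (Suc n)" using C(3)[OF yz(1), of "1 / real (Suc n)"] by auto
      obtain d where d: "d \<in> D" "mdist Z z d < 1 / real (Suc n)" using D(3)[OF yz(2), of "1 / real (Suc n)"] by auto
      have "R (c, d, n) \<subseteq> W"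
      proof
        fix q assume "q \<in> R (c, d, n)"
        then obtain y' z' where q: "q = (y', z')" "y' \<in> mspace Y" "z' \<in> mspace Z"
          "mdist Y c y' < 1 / Suc n" "mdist Z d z' < 1 / Suc n"
          by (auto simp: R_def)
        have "mdist Y y y' < r"
          using mdist_triangle[of y Y c y'] q c C(2) yz n by auto
        moreover have "mdist Z z z' < r"
          using mdist_triangle[of z Z d z'] q d D(2) yz n by auto
        ultimately show "q \<in> W" using r(2) q by auto
      qed
      moreover have "p \<in> R (c, d, n)"
        using yz c d C(2) D(2) by (auto simp: R_def p mdist_commute)
      ultimately show "p \<in> (\<Union>i\<in>I. R i)"
        using c d unfolding I_def by blast
    qed
    then have "W = (\<Union>i\<in>I. R i)" by (auto simp: I_def)
    moreover have "countable I"
      using C(1) D(1) by (auto simp: I_def)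
    moreover have "R i \<in> sets (metric_borel Y \<Otimes>\<^sub>M metric_borel Z)" if "i \<in> I" for i
      using that C(2) D(2)
      by (auto simp: R_def I_def intro!: pair_measureI openin_sets_metric_borel openin_metric_ball)
    ultimately show ?thesis by auto
  qed
  then show "sets (metric_borel (sum_metric Y Z)) \<subseteq> sets (metric_borel Y \<Otimes>\<^sub>M metric_borel Z)"
    unfolding sets_metric_borel[of "sum_metric Y Z"]
    by (intro sets.sigma_sets_subset') (auto simp: space_pair_measure sets.top[of "metric_borel _", simplified] intro!: pair_measureI)
next
  have fst: "fst \<in> metric_borel (sum_metric Y Z) \<rightarrow>\<^sub>M metric_borel Y"
    and snd: "snd \<in> metric_borel (sum_metric Y Z) \<rightarrow>\<^sub>M metric_borel Z"
    by (rule nonexpansive_measurable; auto)+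
  have "A \<times> B \<in> sets (metric_borel (sum_metric Y Z))"
    if "A \<in> sets (metric_borel Y)" "B \<in> sets (metric_borel Z)" for A B
  proof -
    have "A \<times> B = (fst -` A \<inter> space (metric_borel (sum_metric Y Z))) \<inter>
      (snd -` B \<inter> space (metric_borel (sum_metric Y Z)))"
      using that[THEN sets.sets_into_space] by auto
    then show ?thesis
      using measurable_sets[OF fst that(1)] measurable_sets[OF snd that(2)] by (metis sets.Int)
  qed
  then show "sets (metric_borel Y \<Otimes>\<^sub>M metric_borel Z) \<subseteq> sets (metric_borel (sum_metric Y Z))"
    unfolding sets_pair_measure
    by (intro sets.sigma_sets_subset')
       (auto simp: sets.top[of "metric_borel (sum_metric Y Z)", simplified])
qed

lemma mm_space_sum:
  assumes Y: "mm_space (Y, \<mu>)" and Z: "mm_space (Z, \<nu>)"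
  shows "mm_space (sum_metric Y Z, \<mu> \<Otimes>\<^sub>M \<nu>)"
proof -
  note YD = mm_spaceD[OF Y] and ZD = mm_spaceD[OF Z]
  interpret Y: prob_space \<mu> by (rule YD)
  interpret Z: prob_space \<nu> by (rule ZD)
  interpret P: pair_prob_space \<mu> \<nu> ..
  have "mcomplete_of (sum_metric Y Z)"
    unfolding complete_metric_iff
  proof (intro allI impI, elim conjE)
    fix \<sigma> :: "nat \<Rightarrow> 'a \<times> 'b"
    assume r: "range \<sigma> \<subseteq> mspace (sum_metric Y Z)"
      and c: "\<forall>\<epsilon>>0. \<exists>N. \<forall>n n'. N \<le> n \<longrightarrow> N \<le> n' \<longrightarrow> mdist (sum_metric Y Z) (\<sigma> n) (\<sigma> n') < \<epsilon>"
    have le: "mdist Y (fst p) (fst q) \<le> mdist (sum_metric Y Z) p q"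
      "mdist Z (snd p) (snd q) \<le> mdist (sum_metric Y Z) p q" for p q
      by auto
    have "range (\<lambda>n. fst (\<sigma> n)) \<subseteq> mspace Y" "range (\<lambda>n. snd (\<sigma> n)) \<subseteq> mspace Z"
      using r by (auto simp: image_subset_iff mem_Times_iff)
    moreover have "\<forall>\<epsilon>>0. \<exists>N. \<forall>n n'. N \<le> n \<longrightarrow> N \<le> n' \<longrightarrow> mdist Y (fst (\<sigma> n)) (fst (\<sigma> n')) < \<epsilon>"
      "\<forall>\<epsilon>>0. \<exists>N. \<forall>n n'. N \<le> n \<longrightarrow> N \<le> n' \<longrightarrow> mdist Z (snd (\<sigma> n)) (snd (\<sigma> n')) < \<epsilon>"
      using c le by (meson order.strict_trans1)+
    ultimately obtain y z where "y \<in> mspace Y" "(\<lambda>n. mdist Y (fst (\<sigma> n)) y) \<longlonglongrightarrow> 0"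
      "z \<in> mspace Z" "(\<lambda>n. mdist Z (snd (\<sigma> n)) z) \<longlonglongrightarrow> 0"
      using YD(1) ZD(1) unfolding complete_metric_iff by metis
    then show "\<exists>x\<in>mspace (sum_metric Y Z). (\<lambda>n. mdist (sum_metric Y Z) (\<sigma> n) x) \<longlonglongrightarrow> 0"
      by (intro bexI[of _ "(y, z)"]) (auto intro!: tendsto_eq_intros)
  qed
  moreover have "separable_space (mtopology_of (sum_metric Y Z))"
  proof -
    obtain C where C: "countable C" "C \<subseteq> mspace Y" "\<And>x r. x \<in> mspace Y \<Longrightarrow> 0 < r \<Longrightarrow> \<exists>c\<in>C. mdist Y x c < r"
      using YD(2) unfolding separable_metric_iff by metis
    obtain D where D: "countable D" "D \<subseteq> mspace Z" "\<And>x r. x \<in> mspace Z \<Longrightarrow> 0 < r \<Longrightarrow> \<exists>c\<in>D. mdist Z x c < r"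
      using ZD(2) unfolding separable_metric_iff by metis
    have "\<exists>c\<in>C \<times> D. mdist (sum_metric Y Z) x c < r" if "x \<in> mspace Y \<times> mspace Z" "0 < r" for x r
    proof -
      have "fst x \<in> mspace Y" "snd x \<in> mspace Z" "0 < r / 2" using that by auto
      then obtain c d where "c \<in> C" "mdist Y (fst x) c < r / 2" "d \<in> D" "mdist Z (snd x) d < r / 2"
        using C(3) D(3) by metis
      then show ?thesis by (intro bexI[of _ "(c, d)"]) auto
    qed
    then show ?thesis
      using C(1,2) D(1,2) unfolding separable_metric_iff
      by (intro exI[of _ "C \<times> D"]) auto
  qed
  moreover have "sets (\<mu> \<Otimes>\<^sub>M \<nu>) = sets (metric_borel (sum_metric Y Z))"
    using sets_pair_measure_cong[OF YD(5) ZD(5)] sets_metric_borel_sum[OF YD(2) ZD(2)] by simp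
  moreover have "0 < measure (\<mu> \<Otimes>\<^sub>M \<nu>) W"
    if W: "openin (mtopology_of (sum_metric Y Z)) W" "W \<noteq> {}" for W
  proof -
    obtain y z where yz: "(y, z) \<in> W" using W(2) by auto
    then have yz': "y \<in> mspace Y" "z \<in> mspace Z" using openin_subset[OF W(1)] by auto
    obtain r where r: "0 < r"
      "\<And>y' z'. y' \<in> mspace Y \<Longrightarrow> z' \<in> mspace Z \<Longrightarrow> mdist Y y y' < r \<Longrightarrow> mdist Z z z' < r \<Longrightarrow> (y', z') \<in> W"
      using openin_sum_metric_ball_rectangle[OF W(1) yz] by metis
    define A where "A = {y' \<in> mspace Y. mdist Y y y' < r}"
    define B where "B = {z' \<in> mspace Z. mdist Z z z' < r}"
    have AB: "A \<in> sets \<mu>" "B \<in> sets \<nu>"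
      unfolding A_def B_def YD(5) ZD(5) using yz'
      by (auto intro!: openin_sets_metric_borel openin_metric_ball)
    have "0 < measure \<mu> A * measure \<nu> B"
      using measure_ball_pos[OF Y yz'(1) r(1)] measure_ball_pos[OF Z yz'(2) r(1)]
      by (simp add: A_def B_def)
    also have "\<dots> = measure (\<mu> \<Otimes>\<^sub>M \<nu>) (A \<times> B)"
      using AB by (simp add: measure_def Z.emeasure_pair_measure_Times enn2real_mult)
    also have "\<dots> \<le> measure (\<mu> \<Otimes>\<^sub>M \<nu>) W"
    proof (rule P.finite_measure_mono)
      show "A \<times> B \<subseteq> W" using r(2) by (auto simp: A_def B_def)
      show "W \<in> sets (\<mu> \<Otimes>\<^sub>M \<nu>)"
        using openin_sets_metric_borel[OF W(1)] calculation sets_pair_measure_cong[OF YD(5) ZD(5)]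
          sets_metric_borel_sum[OF YD(2) ZD(2)] by simp
    qed
    finally show ?thesis .
  qed
  ultimately show ?thesis
    using P.prob_space_axioms by (auto simp: mm_space_def space_pair_measure YD(4) ZD(4))
qed

lemma scale_metric_simps [simp]:
  assumes "0 < a"
  shows "mspace (scale_metric a X) = mspace X" "mdist (scale_metric a X) x y = a * mdist X x y"
proof -
  interpret Metric_space "mspace X" "\<lambda>x y. a * mdist X x y"
    using assms by unfold_locales (auto simp: mdist_commute distrib_left[symmetric] mdist_triangle)
  show "mspace (scale_metric a X) = mspace X" "mdist (scale_metric a X) x y = a * mdist X x y"
    by (simp_all add: scale_metric_def)
qed

lemma mm_space_scale:
  assumes a: "0 < a" and X: "mm_space (X, \<mu>)"
  shows "mm_space (scale_metric a X, \<mu>)"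
proof -
  note XD = mm_spaceD[OF X]
  have lt: "a * d < e \<longleftrightarrow> d < e / a" for d e using a by (simp add: field_simps)
  have ball: "(\<exists>r>0. \<forall>y\<in>mspace X. a * mdist X x y < r \<longrightarrow> P y) \<longleftrightarrow>
      (\<exists>r>0. \<forall>y\<in>mspace X. mdist X x y < r \<longrightarrow> P y)" for x P
  proof (intro iffI; elim exE conjE)
    fix r :: real assume "0 < r" "\<forall>y\<in>mspace X. a * mdist X x y < r \<longrightarrow> P y"
    then show "\<exists>r>0. \<forall>y\<in>mspace X. mdist X x y < r \<longrightarrow> P y"
      using a by (intro exI[of _ "r / a"]) (simp add: lt)
  next
    fix r :: real assume "0 < r" "\<forall>y\<in>mspace X. mdist X x y < r \<longrightarrow> P y"
    then show "\<exists>r>0. \<forall>y\<in>mspace X. a * mdist X x y < r \<longrightarrow> P y"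
      using a by (intro exI[of _ "a * r"]) simp
  qed
  have top: "mtopology_of (scale_metric a X) = mtopology_of X"
    unfolding topology_eq openin_metric_iff using a by (simp add: ball)
  have "mcomplete_of (scale_metric a X)"
    unfolding complete_metric_iff
  proof (intro allI impI, elim conjE)
    fix \<sigma> :: "nat \<Rightarrow> 'a"
    assume r: "range \<sigma> \<subseteq> mspace (scale_metric a X)"
      and c: "\<forall>\<epsilon>>0. \<exists>N. \<forall>n n'. N \<le> n \<longrightarrow> N \<le> n' \<longrightarrow> mdist (scale_metric a X) (\<sigma> n) (\<sigma> n') < \<epsilon>"
    have "\<forall>\<epsilon>>0. \<exists>N. \<forall>n n'. N \<le> n \<longrightarrow> N \<le> n' \<longrightarrow> mdist X (\<sigma> n) (\<sigma> n') < \<epsilon>"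
    proof (intro allI impI)
      fix \<epsilon> :: real assume "0 < \<epsilon>"
      then show "\<exists>N. \<forall>n n'. N \<le> n \<longrightarrow> N \<le> n' \<longrightarrow> mdist X (\<sigma> n) (\<sigma> n') < \<epsilon>"
        using c[rule_format, of "a * \<epsilon>"] a by simp
    qed
    then obtain x where "x \<in> mspace X" "(\<lambda>n. mdist X (\<sigma> n) x) \<longlonglongrightarrow> 0"
      using XD(1) r a unfolding complete_metric_iff by (metis scale_metric_simps(1))
    then show "\<exists>x\<in>mspace (scale_metric a X). (\<lambda>n. mdist (scale_metric a X) (\<sigma> n) x) \<longlonglongrightarrow> 0"
      using a by (intro bexI[of _ x]) (auto intro!: tendsto_eq_intros)
  qed
  then show ?thesis
    using X a by (simp add: mm_space_def metric_borel_def top)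
qed

section \<open>Lipschitz test functions and the Prohorov condition\<close>

lemma nn_integral_layer_cake:
  fixes g :: "'a \<Rightarrow> real"
  assumes "sigma_finite_measure M" and g [measurable]: "g \<in> borel_measurable M"
    and nonneg: "\<And>z. z \<in> space M \<Longrightarrow> 0 \<le> g z"
  shows "(\<lambda>t. emeasure M {z \<in> space M. t \<le> g z}) \<in> borel_measurable lborel"
    and "(\<integral>\<^sup>+z. ennreal (g z) \<partial>M) = (\<integral>\<^sup>+t. emeasure M {z \<in> space M. t \<le> g z} * indicator {0..} t \<partial>lborel)"
proof -
  interpret sigma_finite_measure M by fact
  interpret pair_sigma_finite lborel M ..
  have [measurable]: "Measurable.pred (borel \<Otimes>\<^sub>M M) (\<lambda>x. fst x \<in> {..g (snd x)})"
    and [measurable]: "\<And>t. Measurable.pred M (\<lambda>z. t \<in> {..g z})"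
    unfolding atMost_iff by measurable
  have eq: "emeasure M {z \<in> space M. t \<le> g z} = (\<integral>\<^sup>+z. indicator {..g z} t \<partial>M)" for t
  proof -
    have "emeasure M {z \<in> space M. t \<le> g z} = (\<integral>\<^sup>+z. indicator {z \<in> space M. t \<le> g z} z \<partial>M)"
      by simp
    also have "\<dots> = (\<integral>\<^sup>+z. indicator {..g z} t \<partial>M)"
      by (intro nn_integral_cong) (auto simp: indicator_def)
    finally show ?thesis .
  qed
  show "(\<lambda>t. emeasure M {z \<in> space M. t \<le> g z}) \<in> borel_measurable lborel"
    unfolding eq by measurable
  have "(\<integral>\<^sup>+z. ennreal (g z) \<partial>M) = (\<integral>\<^sup>+z. \<integral>\<^sup>+t. indicator {..g z} t * indicator {0..} t \<partial>lborel \<partial>M)"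
  proof (intro nn_integral_cong)
    fix z assume "z \<in> space M"
    have "(\<integral>\<^sup>+t. indicator {..g z} t * indicator {0..} t \<partial>lborel) = (\<integral>\<^sup>+t. indicator {0..g z} t \<partial>lborel)"
      by (intro nn_integral_cong) (auto simp: indicator_def)
    then show "ennreal (g z) = (\<integral>\<^sup>+t. indicator {..g z} t * indicator {0..} t \<partial>lborel)"
      using nonneg[OF \<open>z \<in> space M\<close>] by simp
  qed
  also have "\<dots> = (\<integral>\<^sup>+t. \<integral>\<^sup>+z. indicator {..g z} t * indicator {0..} t \<partial>M \<partial>lborel)"
    by (rule Fubini') measurable
  also have "\<dots> = (\<integral>\<^sup>+t. emeasure M {z \<in> space M. t \<le> g z} * indicator {0..} t \<partial>lborel)"
    unfolding eq by (intro nn_integral_cong nn_integral_multc) measurable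
  finally show "(\<integral>\<^sup>+z. ennreal (g z) \<partial>M) = (\<integral>\<^sup>+t. emeasure M {z \<in> space M. t \<le> g z} * indicator {0..} t \<partial>lborel)" .
qed

text \<open>
  The Prohorov condition compares the masses of closed sets. For Lipschitz \<open>f\<close> it applies to the
  superlevel sets \<open>{t \<le> f}\<close>: the \<open>\<epsilon>\<close>-neighbourhood of such a set lies in \<open>{t \<le> f + L * \<epsilon>}\<close>.
  Integrating over the levels \<open>t\<close> in \<open>[0, 1]\<close> costs \<open>L * \<epsilon>\<close> for the shift of the level and \<open>\<epsilon>\<close> for the
  defect of mass. The condition is one-sided, but the reverse inequality follows by applying the
  lemma to \<open>1 - f\<close>.
\<close>

lemma lipschitz_integral_le:
  fixes f :: "'a \<Rightarrow> real"
  assumes P: "prob_space P" "sets P = sets (metric_borel Z)"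
    and Q: "prob_space Q" "sets Q = sets (metric_borel Z)"
    and \<epsilon>: "0 \<le> \<epsilon>"
    and PQ: "\<And>F. closedin (mtopology_of Z) F \<Longrightarrow>
        measure P F \<le> measure Q {z \<in> mspace Z. \<exists>w\<in>F. mdist Z z w < \<epsilon>} + \<epsilon>"
    and L: "0 \<le> L"
    and f: "\<And>x y. x \<in> mspace Z \<Longrightarrow> y \<in> mspace Z \<Longrightarrow> \<bar>f x - f y\<bar> \<le> L * mdist Z x y"
    and f01: "\<And>x. x \<in> mspace Z \<Longrightarrow> 0 \<le> f x \<and> f x \<le> 1"
  shows "(\<integral>x. f x \<partial>P) \<le> (\<integral>x. f x \<partial>Q) + (L + 1) * \<epsilon>"
proof -
  interpret P: prob_space P by fact
  interpret Q: prob_space Q by fact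
  have sp: "space P = mspace Z" "space Q = mspace Z"
    using sets_eq_imp_space_eq[OF P(2)] sets_eq_imp_space_eq[OF Q(2)] by simp_all
  have m: "f \<in> borel_measurable (metric_borel Z)"
    by (rule lipschitz_borel_measurable[OF L f])
  have mP [measurable]: "f \<in> borel_measurable P" and mQ [measurable]: "f \<in> borel_measurable Q"
    using m P(2) Q(2) by (simp_all cong: measurable_cong_sets)
  have level: "emeasure P {z \<in> space P. t \<le> f z} \<le> emeasure Q {z \<in> space Q. t \<le> f z + L * \<epsilon>} + ennreal \<epsilon>" for t
  proof -
    define F where "F = {z \<in> mspace Z. t \<le> f z}"
    have "closedin (mtopology_of Z) F"
    proof -
      have "mspace Z - F = {z \<in> mspace Z. f z \<in> {..<t}}" by (auto simp: F_def)
      then show ?thesis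
        using openin_lipschitz_preimage[OF L f, of "{..<t}"] by (auto simp: closedin_def F_def)
    qed
    from PQ[OF this] have "measure P F \<le> measure Q {z \<in> mspace Z. \<exists>w\<in>F. mdist Z z w < \<epsilon>} + \<epsilon>" .
    also have "\<dots> \<le> measure Q {z \<in> space Q. t \<le> f z + L * \<epsilon>} + \<epsilon>"
    proof (intro add_right_mono Q.finite_measure_mono subsetI)
      fix z assume "z \<in> {z \<in> mspace Z. \<exists>w\<in>F. mdist Z z w < \<epsilon>}"
      then obtain w where w: "z \<in> mspace Z" "w \<in> mspace Z" "t \<le> f w" "mdist Z z w < \<epsilon>"
        by (auto simp: F_def)
      have "f w - f z \<le> L * mdist Z z w" using f[of z w] w by linarith
      also have "\<dots> \<le> L * \<epsilon>" using w L by (intro mult_left_mono) auto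
      finally show "z \<in> {z \<in> space Q. t \<le> f z + L * \<epsilon>}" using w sp by auto
    qed measurable
    finally show ?thesis
      using \<epsilon> by (simp add: F_def sp P.emeasure_eq_measure Q.emeasure_eq_measure flip: ennreal_plus)
  qed
  have mQ': "(\<lambda>z. f z + L * \<epsilon>) \<in> borel_measurable Q" by measurable
  have nonneg': "0 \<le> f z + L * \<epsilon>" if "z \<in> space Q" for z using f01[of z] that sp L \<epsilon> by simp
  note cakeQ = nn_integral_layer_cake[OF Q.sigma_finite_measure_axioms mQ' nonneg']
  have [measurable]: "(\<lambda>t. emeasure Q {z \<in> space Q. t \<le> f z + L * \<epsilon>}) \<in> borel_measurable lborel"
    by (rule cakeQ(1))
  have intP: "integrable P f" and intQ: "integrable Q f"
    using f01 sp by (auto intro!: P.integrable_const_bound[of _ 1] Q.integrable_const_bound[of _ 1])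
  have "ennreal (\<integral>x. f x \<partial>P) = (\<integral>\<^sup>+x. ennreal (f x) \<partial>P)"
    using f01 sp intP by (intro nn_integral_eq_integral[symmetric]) auto
  also have "\<dots> = (\<integral>\<^sup>+t. emeasure P {z \<in> space P. t \<le> f z} * indicator {0..} t \<partial>lborel)"
    by (rule nn_integral_layer_cake(2)[OF P.sigma_finite_measure_axioms mP]) (use f01 sp in auto)
  also have "\<dots> \<le> (\<integral>\<^sup>+t. emeasure Q {z \<in> space Q. t \<le> f z + L * \<epsilon>} * indicator {0..} t
      + ennreal \<epsilon> * indicator {0..1} t \<partial>lborel)"
  proof (rule nn_integral_mono)
    fix t :: real
    have "emeasure P {z \<in> space P. t \<le> f z} = 0" if "1 < t"
    proof -
      have "{z \<in> space P. t \<le> f z} = {}" using f01 sp that by force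
      then show ?thesis by (simp only: emeasure_empty)
    qed
    then show "emeasure P {z \<in> space P. t \<le> f z} * indicator {0..} t \<le>
        emeasure Q {z \<in> space Q. t \<le> f z + L * \<epsilon>} * indicator {0..} t + ennreal \<epsilon> * indicator {0..1} t"
      using level[of t] by (cases "t \<le> 1") (auto simp: indicator_def)
  qed
  also have "\<dots> = (\<integral>\<^sup>+t. emeasure Q {z \<in> space Q. t \<le> f z + L * \<epsilon>} * indicator {0..} t \<partial>lborel)
      + (\<integral>\<^sup>+t. ennreal \<epsilon> * indicator {0..1::real} t \<partial>lborel)"
    by (rule nn_integral_add) measurable
  also have "(\<integral>\<^sup>+t. emeasure Q {z \<in> space Q. t \<le> f z + L * \<epsilon>} * indicator {0..} t \<partial>lborel)
      = (\<integral>\<^sup>+z. ennreal (f z + L * \<epsilon>) \<partial>Q)"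
    by (rule cakeQ(2)[symmetric])
  also have "\<dots> = ennreal (\<integral>z. f z + L * \<epsilon> \<partial>Q)"
    using intQ nonneg' by (intro nn_integral_eq_integral) auto
  also have "(\<integral>z. f z + L * \<epsilon> \<partial>Q) = (\<integral>z. f z \<partial>Q) + L * \<epsilon>"
    using intQ by (simp add: Q.prob_space)
  also have "(\<integral>\<^sup>+t. ennreal \<epsilon> * indicator {0..1::real} t \<partial>lborel) = ennreal \<epsilon>"
    by (simp add: nn_integral_cmult_indicator)
  finally have "ennreal (\<integral>x. f x \<partial>P) \<le> ennreal ((\<integral>z. f z \<partial>Q) + L * \<epsilon> + \<epsilon>)"
    using f01 sp L \<epsilon> by (subst ennreal_plus) (auto intro!: add_nonneg_nonneg Bochner_Integration.integral_nonneg_AE)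
  then have "(\<integral>x. f x \<partial>P) \<le> (\<integral>z. f z \<partial>Q) + L * \<epsilon> + \<epsilon>"
    using f01 sp L \<epsilon> by (subst (asm) ennreal_le_iff) (auto intro!: add_nonneg_nonneg Bochner_Integration.integral_nonneg_AE)
  then show ?thesis by (simp add: algebra_simps)
qed

section \<open>The Laplace transform of the distance of two random points\<close>

text \<open>
  The integral is iterated, not taken over a product measure: it then makes sense on every metric
  space, also on a non-separable one, where \<open>mdist X\<close> may fail to be measurable for the product
  algebra.
\<close>

definition dist_laplace :: "real \<Rightarrow> 'a mm \<Rightarrow> real" where
  "dist_laplace l = (\<lambda>(X, \<mu>). \<integral>x. \<integral>y. exp (- (l * mdist X x y)) \<partial>\<mu> \<partial>\<mu>)"

lemma exp_neg_lipschitz: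
  fixes a b :: real
  assumes "0 \<le> a" "0 \<le> b"
  shows "\<bar>exp (- a) - exp (- b)\<bar> \<le> \<bar>a - b\<bar>"
proof -
  have *: "\<bar>exp (- a) - exp (- b)\<bar> \<le> \<bar>a - b\<bar>" if "0 \<le> a" "a \<le> b" for a b :: real
  proof -
    have "1 - exp (- (b - a)) \<le> b - a"
      using exp_ge_add_one_self[of "- (b - a)"] by linarith
    moreover have "exp (- a) - exp (- b) = exp (- a) * (1 - exp (- (b - a)))"
      by (simp add: right_diff_distrib flip: exp_add)
    ultimately have "exp (- a) - exp (- b) \<le> 1 * (b - a)"
      using that by (simp only:) (intro mult_mono, auto)
    then show ?thesis using that by simp
  qed
  show ?thesis using *[of a b] *[of b a] assms by (cases "a \<le> b") (auto simp: abs_minus_commute)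
qed

lemma exp_dist_lipschitz:
  assumes "0 \<le> l" "x \<in> mspace X" "y \<in> mspace X" "z \<in> mspace X"
  shows "\<bar>exp (- (l * mdist X x z)) - exp (- (l * mdist X y z))\<bar> \<le> l * mdist X x y"
    and "\<bar>exp (- (l * mdist X z x)) - exp (- (l * mdist X z y))\<bar> \<le> l * mdist X x y"
proof -
  have "\<bar>exp (- (l * mdist X x z)) - exp (- (l * mdist X y z))\<bar> \<le> \<bar>l * mdist X x z - l * mdist X y z\<bar>"
    using assms by (intro exp_neg_lipschitz) auto
  also have "\<dots> = l * \<bar>mdist X x z - mdist X y z\<bar>"
    using assms by (simp add: abs_mult flip: right_diff_distrib)
  also have "\<dots> \<le> l * mdist X x y"
    using assms mdist_triangle[of x X y z] mdist_triangle[of y X x z] mdist_commute[of X x y]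
    by (intro mult_left_mono) (auto simp: abs_le_iff)
  finally show "\<bar>exp (- (l * mdist X x z)) - exp (- (l * mdist X y z))\<bar> \<le> l * mdist X x y" .
  then show "\<bar>exp (- (l * mdist X z x)) - exp (- (l * mdist X z y))\<bar> \<le> l * mdist X x y"
    by (simp add: mdist_commute)
qed

text \<open>
  This is the generality of the Prohorov condition: the images of two metric measure spaces in a common
  ambient space are just Borel probability measures there. The kernel is Lipschitz in each variable,
  which yields the measurability that the iterated integral needs.
\<close>

locale metric_prob = prob_space \<mu> for X :: "'a metric" and \<mu> :: "'a measure" +
  assumes sets_eq: "sets \<mu> = sets (metric_borel X)"
begin

lemma space_eq: "space \<mu> = mspace X"
  using sets_eq_imp_space_eq[OF sets_eq] by simp

lemma lipschitz_measurable:
  fixes f :: "'a \<Rightarrow> real"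
  assumes "0 \<le> L"
    and "\<And>x y. x \<in> mspace X \<Longrightarrow> y \<in> mspace X \<Longrightarrow> \<bar>f x - f y\<bar> \<le> L * mdist X x y"
  shows "f \<in> borel_measurable \<mu>"
  using lipschitz_borel_measurable[OF assms] sets_eq by (simp cong: measurable_cong_sets)

lemma kernel_measurable:
  assumes "0 \<le> l" "x \<in> mspace X"
  shows "(\<lambda>y. exp (- (l * mdist X x y))) \<in> borel_measurable \<mu>"
  by (rule lipschitz_measurable[of l]) (use assms exp_dist_lipschitz(2) in auto)

lemma kernel_integrable:
  assumes "0 \<le> l" "x \<in> mspace X"
  shows "integrable \<mu> (\<lambda>y. exp (- (l * mdist X x y)))"
  by (rule integrable_const_bound[of _ 1]) (use assms kernel_measurable in auto)

lemma potential_bounds: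
  assumes "0 \<le> l" "x \<in> mspace X"
  shows "0 \<le> (\<integral>y. exp (- (l * mdist X x y)) \<partial>\<mu>)" "(\<integral>y. exp (- (l * mdist X x y)) \<partial>\<mu>) \<le> 1"
  using assms by (auto intro!: integral_le_const kernel_integrable)

lemma potential_lipschitz:
  assumes "0 \<le> l" "x \<in> mspace X" "x' \<in> mspace X"
  shows "\<bar>(\<integral>y. exp (- (l * mdist X x y)) \<partial>\<mu>) - (\<integral>y. exp (- (l * mdist X x' y)) \<partial>\<mu>)\<bar> \<le> l * mdist X x x'"
proof -
  have "\<bar>(\<integral>y. exp (- (l * mdist X x y)) \<partial>\<mu>) - (\<integral>y. exp (- (l * mdist X x' y)) \<partial>\<mu>)\<bar>
      = \<bar>\<integral>y. exp (- (l * mdist X x y)) - exp (- (l * mdist X x' y)) \<partial>\<mu>\<bar>"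
    using assms by (simp add: Bochner_Integration.integral_diff kernel_integrable)
  also have "\<dots> \<le> (\<integral>y. \<bar>exp (- (l * mdist X x y)) - exp (- (l * mdist X x' y))\<bar> \<partial>\<mu>)"
    by (rule integral_abs_bound)
  also have "\<dots> \<le> l * mdist X x x'"
    using assms exp_dist_lipschitz(1)[of l x X x']
    by (intro integral_le_const integrable_abs Bochner_Integration.integrable_diff kernel_integrable)
       (auto simp: space_eq)
  finally show ?thesis .
qed

lemma potential_integrable:
  assumes "0 \<le> l"
  shows "integrable \<mu> (\<lambda>x. \<integral>y. exp (- (l * mdist X x y)) \<partial>\<mu>)"
  by (rule integrable_const_bound[of _ 1])
     (use assms potential_bounds in \<open>auto simp: space_eq intro!: lipschitz_measurable[of l] potential_lipschitz\<close>)

lemma dist_laplace_bounds: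
  assumes "0 \<le> l"
  shows "0 \<le> dist_laplace l (X, \<mu>)" "dist_laplace l (X, \<mu>) \<le> 1"
proof -
  show "0 \<le> dist_laplace l (X, \<mu>)" by (simp add: dist_laplace_def)
  show "dist_laplace l (X, \<mu>) \<le> 1"
    unfolding dist_laplace_def prod.case
    using assms by (intro integral_le_const[OF potential_integrable] AE_I2 potential_bounds(2)) (simp_all add: space_eq)
qed

end

lemma metric_prob_mm_space: "mm_space (X, \<mu>) \<Longrightarrow> metric_prob X \<mu>"
  by (auto simp: mm_space_def metric_prob_def metric_prob_axioms_def)

text \<open>
  The kernel and the potential \<open>x \<mapsto> \<integral>y. exp (- (l * mdist Z x y)) \<partial>Q\<close> are \<open>l\<close>-Lipschitz with values in
  \<open>[0, 1]\<close>, so \<open>P\<close> can be replaced by \<open>Q\<close> in one variable at a time.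
\<close>

lemma dist_laplace_prohorov:
  assumes P: "metric_prob Z P" and Q: "metric_prob Z Q" and l: "0 \<le> l" and \<epsilon>: "0 \<le> \<epsilon>"
    and PQ: "\<And>F. closedin (mtopology_of Z) F \<Longrightarrow>
        measure P F \<le> measure Q {z \<in> mspace Z. \<exists>w\<in>F. mdist Z z w < \<epsilon>} + \<epsilon>"
  shows "\<bar>dist_laplace l (Z, P) - dist_laplace l (Z, Q)\<bar> \<le> 2 * (l + 1) * \<epsilon>"
proof -
  interpret P: metric_prob Z P by fact
  interpret Q: metric_prob Z Q by fact
  have le: "\<bar>(\<integral>x. f x \<partial>P) - (\<integral>x. f x \<partial>Q)\<bar> \<le> (l + 1) * \<epsilon>"
    if lip: "\<And>x y. x \<in> mspace Z \<Longrightarrow> y \<in> mspace Z \<Longrightarrow> \<bar>f x - f y\<bar> \<le> l * mdist Z x y"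
      and f01: "\<And>x. x \<in> mspace Z \<Longrightarrow> 0 \<le> f x \<and> f x \<le> 1" for f :: "'a \<Rightarrow> real"
  proof -
    note * = lipschitz_integral_le[OF P.prob_space_axioms P.sets_eq Q.prob_space_axioms Q.sets_eq \<epsilon> PQ l]
    have "f \<in> borel_measurable P" "f \<in> borel_measurable Q"
      using P.lipschitz_measurable[OF l lip] Q.lipschitz_measurable[OF l lip] by auto
    then have int: "integrable P f" "integrable Q f"
      using f01 by (auto simp: P.space_eq Q.space_eq intro!: P.integrable_const_bound[of _ 1] Q.integrable_const_bound[of _ 1])
    have "(\<integral>x. f x \<partial>P) \<le> (\<integral>x. f x \<partial>Q) + (l + 1) * \<epsilon>"
      by (rule *) (use lip f01 in auto)
    moreover have "(\<integral>x. 1 - f x \<partial>P) \<le> (\<integral>x. 1 - f x \<partial>Q) + (l + 1) * \<epsilon>"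
      by (rule *) (use lip f01 in \<open>auto simp: abs_minus_commute\<close>)
    ultimately show ?thesis
      using int by (simp add: P.prob_space Q.prob_space abs_le_iff)
  qed
  have "\<bar>dist_laplace l (Z, P) - (\<integral>x. \<integral>y. exp (- (l * mdist Z x y)) \<partial>Q \<partial>P)\<bar> \<le> (l + 1) * \<epsilon>"
  proof -
    have int: "integrable P (\<lambda>x. \<integral>y. exp (- (l * mdist Z x y)) \<partial>Q)"
      by (rule P.integrable_const_bound[of _ 1])
         (use l Q.potential_bounds in \<open>auto simp: P.space_eq intro!: P.lipschitz_measurable[of l] Q.potential_lipschitz\<close>)
    have "\<bar>dist_laplace l (Z, P) - (\<integral>x. \<integral>y. exp (- (l * mdist Z x y)) \<partial>Q \<partial>P)\<bar>
        = \<bar>\<integral>x. (\<integral>y. exp (- (l * mdist Z x y)) \<partial>P) - (\<integral>y. exp (- (l * mdist Z x y)) \<partial>Q) \<partial>P\<bar>"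
      using int P.potential_integrable[OF l] by (simp add: dist_laplace_def)
    also have "\<dots> \<le> (\<integral>x. \<bar>(\<integral>y. exp (- (l * mdist Z x y)) \<partial>P) - (\<integral>y. exp (- (l * mdist Z x y)) \<partial>Q)\<bar> \<partial>P)"
      by (rule integral_abs_bound)
    also have "\<dots> \<le> (l + 1) * \<epsilon>"
      using int P.potential_integrable[OF l] l exp_dist_lipschitz(2)[OF l]
      by (intro P.integral_le_const integrable_abs Bochner_Integration.integrable_diff)
         (auto simp: P.space_eq intro!: AE_I2 le)
    finally show ?thesis .
  qed
  moreover have "\<bar>(\<integral>x. \<integral>y. exp (- (l * mdist Z x y)) \<partial>Q \<partial>P) - dist_laplace l (Z, Q)\<bar> \<le> (l + 1) * \<epsilon>"
    unfolding dist_laplace_def prod.case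
    by (rule le) (use l Q.potential_bounds Q.potential_lipschitz in auto)
  ultimately show ?thesis by (simp add: algebra_simps abs_le_iff)
qed

lemma dist_laplace_distr:
  assumes \<phi>: "isometric_embedding X Z \<phi>" and \<mu>: "metric_prob X \<mu>" and l: "0 \<le> l"
  shows "metric_prob Z (distr \<mu> (metric_borel Z) \<phi>)"
    and "dist_laplace l (Z, distr \<mu> (metric_borel Z) \<phi>) = dist_laplace l (X, \<mu>)"
proof -
  interpret metric_prob X \<mu> by fact
  have m [measurable]: "\<phi> \<in> \<mu> \<rightarrow>\<^sub>M metric_borel Z"
    using isometric_embedding_measurable[OF \<phi>] sets_eq by (simp cong: measurable_cong_sets)
  interpret D: prob_space "distr \<mu> (metric_borel Z) \<phi>"
    by (rule prob_space_distr[OF m])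
  show D: "metric_prob Z (distr \<mu> (metric_borel Z) \<phi>)"
    by unfold_locales simp
  interpret D: metric_prob Z "distr \<mu> (metric_borel Z) \<phi>" by (rule D)
  have \<phi>M: "\<phi> x \<in> mspace Z" if "x \<in> mspace X" for x
    using \<phi> that by (auto simp: isometric_embedding_def)
  have inner: "(\<integral>w. exp (- (l * mdist Z (\<phi> x) w)) \<partial>distr \<mu> (metric_borel Z) \<phi>)
      = (\<integral>y. exp (- (l * mdist X x y)) \<partial>\<mu>)" if x: "x \<in> mspace X" for x
  proof -
    have "(\<lambda>w. exp (- (l * mdist Z (\<phi> x) w))) \<in> borel_measurable (metric_borel Z)"
      using D.kernel_measurable[OF l \<phi>M[OF x]] by simp
    then have "(\<integral>w. exp (- (l * mdist Z (\<phi> x) w)) \<partial>distr \<mu> (metric_borel Z) \<phi>)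
        = (\<integral>y. exp (- (l * mdist Z (\<phi> x) (\<phi> y))) \<partial>\<mu>)"
      by (rule integral_distr[OF m])
    also have "\<dots> = (\<integral>y. exp (- (l * mdist X x y)) \<partial>\<mu>)"
      using \<phi> x by (intro Bochner_Integration.integral_cong) (auto simp: space_eq isometric_embedding_def)
    finally show ?thesis .
  qed
  have "(\<lambda>z. \<integral>w. exp (- (l * mdist Z z w)) \<partial>distr \<mu> (metric_borel Z) \<phi>) \<in> borel_measurable (metric_borel Z)"
    using borel_measurable_integrable[OF D.potential_integrable[OF l]] by simp
  then have "dist_laplace l (Z, distr \<mu> (metric_borel Z) \<phi>)
      = (\<integral>x. \<integral>w. exp (- (l * mdist Z (\<phi> x) w)) \<partial>distr \<mu> (metric_borel Z) \<phi> \<partial>\<mu>)"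
    unfolding dist_laplace_def prod.case by (rule integral_distr[OF m])
  also have "\<dots> = dist_laplace l (X, \<mu>)"
    unfolding dist_laplace_def prod.case
    by (intro Bochner_Integration.integral_cong) (auto simp: inner space_eq)
  finally show "dist_laplace l (Z, distr \<mu> (metric_borel Z) \<phi>) = dist_laplace l (X, \<mu>)" .
qed

lemma dist_laplace_mm_equiv:
  assumes "mm_equiv \<X> \<Y>" "0 \<le> l"
  shows "dist_laplace l \<X> = dist_laplace l \<Y>"
  using assms dist_laplace_distr(2) metric_prob_mm_space
  by (cases \<X>, cases \<Y>) (fastforce simp: mm_equiv_def)

text \<open>
  The exponential turns the sum of the two distances into a product, and the two coordinates of a
  random point are independent under the product measure.
\<close>

lemma dist_laplace_sum:
  assumes Y: "metric_prob Y \<mu>" and Z: "metric_prob Z \<nu>" and l: "0 \<le> l"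
  shows "dist_laplace l (sum_metric Y Z, \<mu> \<Otimes>\<^sub>M \<nu>) = dist_laplace l (Y, \<mu>) * dist_laplace l (Z, \<nu>)"
proof -
  interpret Y: metric_prob Y \<mu> by fact
  interpret Z: metric_prob Z \<nu> by fact
  interpret P: pair_sigma_finite \<mu> \<nu> ..
  have prod: "(\<integral>p. f (fst p) * g (snd p) \<partial>(\<mu> \<Otimes>\<^sub>M \<nu>)) = (\<integral>y. f y \<partial>\<mu>) * (\<integral>z. g z \<partial>\<nu>)"
    if "integrable \<mu> f" "integrable \<nu> g" for f g :: "_ \<Rightarrow> real"
  proof -
    have "integrable (\<mu> \<Otimes>\<^sub>M \<nu>) (\<lambda>p. f (fst p) * g (snd p))"
      by (rule P.Fubini_integrable) (use that in \<open>auto simp: abs_mult\<close>)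
    then have "(\<integral>p. f (fst p) * g (snd p) \<partial>(\<mu> \<Otimes>\<^sub>M \<nu>)) = (\<integral>y. \<integral>z. f y * g z \<partial>\<nu> \<partial>\<mu>)"
      using P.integral_fst'[of "\<lambda>p. f (fst p) * g (snd p)"] by simp
    then show ?thesis using that by simp
  qed
  have "dist_laplace l (sum_metric Y Z, \<mu> \<Otimes>\<^sub>M \<nu>) =
     (\<integral>p. \<integral>q. exp (- (l * mdist Y (fst p) (fst q))) * exp (- (l * mdist Z (snd p) (snd q))) \<partial>(\<mu> \<Otimes>\<^sub>M \<nu>) \<partial>(\<mu> \<Otimes>\<^sub>M \<nu>))"
    by (simp add: dist_laplace_def distrib_left flip: exp_add)
  also have "\<dots> = (\<integral>p. (\<integral>y. exp (- (l * mdist Y (fst p) y)) \<partial>\<mu>) * (\<integral>z. exp (- (l * mdist Z (snd p) z)) \<partial>\<nu>) \<partial>(\<mu> \<Otimes>\<^sub>M \<nu>))"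
    using l by (intro Bochner_Integration.integral_cong refl prod Y.kernel_integrable Z.kernel_integrable)
      (auto simp: space_pair_measure Y.space_eq Z.space_eq)
  also have "\<dots> = dist_laplace l (Y, \<mu>) * dist_laplace l (Z, \<nu>)"
    using prod[OF Y.potential_integrable[OF l] Z.potential_integrable[OF l]] by (simp add: dist_laplace_def)
  finally show ?thesis .
qed

lemma dist_laplace_scale:
  "0 < a \<Longrightarrow> dist_laplace l (scale_metric a X, \<mu>) = dist_laplace (l * a) (X, \<mu>)"
  by (simp add: dist_laplace_def mult.assoc)

text \<open>
  Convexity of \<open>s \<mapsto> exp (- (s * d))\<close> on \<open>[0, 1]\<close>, integrated. This linear bound near \<open>s = 0\<close> also covers
  spaces in which the distance of two random points is not integrable.
\<close>

lemma dist_laplace_le_convex: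
  assumes \<mu>: "metric_prob X \<mu>" and s: "0 \<le> s" "s \<le> 1"
  shows "dist_laplace s (X, \<mu>) \<le> 1 - s * (1 - dist_laplace 1 (X, \<mu>))"
proof -
  interpret metric_prob X \<mu> by fact
  have pt: "exp (- (s * d)) \<le> (1 - s) + s * exp (- d)" for d :: real
    using convex_onD[OF exp_convex, of s 0 "- d"] s by simp
  have pt': "(\<integral>y. exp (- (s * mdist X x y)) \<partial>\<mu>) \<le> (1 - s) + s * (\<integral>y. exp (- (1 * mdist X x y)) \<partial>\<mu>)"
    if x: "x \<in> mspace X" for x
  proof -
    have "(\<integral>y. exp (- (s * mdist X x y)) \<partial>\<mu>) \<le> (\<integral>y. (1 - s) + s * exp (- (1 * mdist X x y)) \<partial>\<mu>)"
      using s x kernel_integrable[of 1 x] kernel_integrable[of s x] pt by (intro integral_mono) auto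
    then show ?thesis using kernel_integrable[of 1 x] x by (simp add: prob_space)
  qed
  have "dist_laplace s (X, \<mu>) \<le> (\<integral>x. (1 - s) + s * (\<integral>y. exp (- (1 * mdist X x y)) \<partial>\<mu>) \<partial>\<mu>)"
    unfolding dist_laplace_def prod.case
    using s potential_integrable[of 1] potential_integrable[of s] pt'
    by (intro integral_mono) (auto simp: space_eq)
  also have "\<dots> = (1 - s) + s * dist_laplace 1 (X, \<mu>)"
    using potential_integrable[of 1] by (simp add: prob_space dist_laplace_def)
  finally show ?thesis by (simp add: algebra_simps)
qed

text \<open>
  Two independent points both fall into a ball of radius \<open>\<delta> / 2\<close> with a probability \<open>\<kappa>\<close> that is
  positive by full support. Hence the Laplace transform of a single space decays more slowly than
  every exponential.
\<close>

lemma dist_laplace_lower: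
  assumes X: "mm_space (X, \<mu>)" and \<delta>: "0 < \<delta>"
  obtains \<kappa> where "0 < \<kappa>" "\<And>l. 0 \<le> l \<Longrightarrow> \<kappa> * exp (- (l * \<delta>)) \<le> dist_laplace l (X, \<mu>)"
proof -
  interpret metric_prob X \<mu> by (rule metric_prob_mm_space[OF X])
  obtain p where p: "p \<in> mspace X" using not_empty space_eq by auto
  define B where "B = {y \<in> mspace X. mdist X p y < \<delta> / 2}"
  have B: "B \<in> sets \<mu>" unfolding B_def sets_eq by (intro openin_sets_metric_borel openin_metric_ball p)
  have ind: "integrable \<mu> (indicator B :: 'a \<Rightarrow> real)"
    by (rule integrable_real_indicator[OF B]) (simp add: emeasure_eq_measure)
  have pos: "0 < measure \<mu> B" unfolding B_def using measure_ball_pos[OF X p, of "\<delta> / 2"] \<delta> by simp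
  have "measure \<mu> B * measure \<mu> B * exp (- (l * \<delta>)) \<le> dist_laplace l (X, \<mu>)" if l: "0 \<le> l" for l
  proof -
    have d: "mdist X x y \<le> \<delta>" if "x \<in> B" "y \<in> B" for x y
      using that mdist_triangle[of x X p y] p by (auto simp: B_def mdist_commute)
    have "exp (- (l * \<delta>)) * measure \<mu> B \<le> (\<integral>y. exp (- (l * mdist X x y)) \<partial>\<mu>)" if x: "x \<in> B" for x
    proof -
      have xX: "x \<in> mspace X" using x by (simp add: B_def)
      have "(\<integral>y. exp (- (l * \<delta>)) * indicator B y \<partial>\<mu>) \<le> (\<integral>y. exp (- (l * mdist X x y)) \<partial>\<mu>)"
      proof (intro integral_mono kernel_integrable)
        show "exp (- (l * \<delta>)) * indicator B y \<le> exp (- (l * mdist X x y))" for y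
          using l d[OF x, of y] by (auto simp: indicator_def intro!: mult_left_mono)
      qed (use l xX ind in auto)
      then show ?thesis using B by simp
    qed
    then have "(\<integral>x. exp (- (l * \<delta>)) * measure \<mu> B * indicator B x \<partial>\<mu>) \<le> dist_laplace l (X, \<mu>)"
      unfolding dist_laplace_def prod.case
    proof (intro integral_mono potential_integrable)
      show "integrable \<mu> (\<lambda>x. exp (- (l * \<delta>)) * measure \<mu> B * indicator B x)"
        by (simp add: ind)
    qed (use l in \<open>auto simp: indicator_def\<close>)
    then show ?thesis using B by (simp add: mult_ac)
  qed
  moreover have "0 < measure \<mu> B * measure \<mu> B" using pos by simp
  ultimately show ?thesis using that by blast
qed

text \<open>
  By full support, two independent points lie near \<open>p\<close> and near \<open>q\<close> with positive probability, and
  are then bounded away from each other.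
\<close>

lemma dist_laplace_less_one:
  assumes X: "mm_space (X, \<mu>)" and pq: "p \<in> mspace X" "q \<in> mspace X" "p \<noteq> q"
  shows "dist_laplace 1 (X, \<mu>) < 1"
proof -
  interpret metric_prob X \<mu> by (rule metric_prob_mm_space[OF X])
  define \<delta> where "\<delta> = mdist X p q / 3"
  have \<delta>: "0 < \<delta>"
    using pq mdist_zero[of p X q] mdist_nonneg[of X p q] by (simp add: \<delta>_def order_less_le)
  define A where "A = {y \<in> mspace X. mdist X p y < \<delta>}"
  define B where "B = {y \<in> mspace X. mdist X q y < \<delta>}"
  have AB: "A \<in> sets \<mu>" "B \<in> sets \<mu>"
    unfolding A_def B_def sets_eq by (intro openin_sets_metric_borel openin_metric_ball pq)+
  have [simp]: "integrable \<mu> (indicator A :: 'a \<Rightarrow> real)" "integrable \<mu> (indicator B :: 'a \<Rightarrow> real)"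
    using AB by (auto intro!: integrable_real_indicator simp: emeasure_eq_measure)
  have pos: "0 < measure \<mu> A" "0 < measure \<mu> B"
    unfolding A_def B_def using measure_ball_pos[OF X pq(1) \<delta>] measure_ball_pos[OF X pq(2) \<delta>] by auto
  define c where "c = 1 - exp (- \<delta>)"
  have c: "0 < c" using \<delta> by (simp add: c_def)
  have inner: "(\<integral>y. exp (- (1 * mdist X x y)) \<partial>\<mu>) \<le> 1 - c * measure \<mu> B" if x: "x \<in> A" for x
  proof -
    have "(\<integral>y. exp (- (1 * mdist X x y)) \<partial>\<mu>) \<le> (\<integral>y. 1 - c * indicator B y \<partial>\<mu>)"
    proof (intro integral_mono kernel_integrable)
      fix y assume "y \<in> space \<mu>"
      have "\<delta> \<le> mdist X x y" if "y \<in> B"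
        using x that mdist_triangle[of p X x q] mdist_triangle[of x X y q] pq
        by (auto simp: A_def B_def \<delta>_def mdist_commute)
      then show "exp (- (1 * mdist X x y)) \<le> 1 - c * indicator B y"
        by (auto simp: indicator_def c_def)
    qed (use x AB(2) in \<open>auto simp: A_def intro!: Bochner_Integration.integrable_diff\<close>)
    then show ?thesis using AB by (simp add: prob_space)
  qed
  have "dist_laplace 1 (X, \<mu>) \<le> (\<integral>x. 1 - c * measure \<mu> B * indicator A x \<partial>\<mu>)"
    unfolding dist_laplace_def prod.case
  proof (intro integral_mono potential_integrable)
    fix x assume "x \<in> space \<mu>"
    then show "(\<integral>y. exp (- (1 * mdist X x y)) \<partial>\<mu>) \<le> 1 - c * measure \<mu> B * indicator A x"
      using inner[of x] potential_bounds(2)[of 1 x] by (auto simp: indicator_def space_eq)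
  qed (auto intro!: Bochner_Integration.integrable_diff)
  also have "\<dots> = 1 - c * measure \<mu> B * measure \<mu> A" using AB by (simp add: prob_space)
  also have "\<dots> < 1" using c pos by simp
  finally show ?thesis .
qed

section \<open>The Laplace transform on equivalence classes\<close>

lemma rep_mmclass_mm_space: "mm_space (rep_mmclass x)"
proof -
  have "mm_equiv (rep_mmclass x) (rep_mmclass x)"
    by (rule Quotient3_rep_reflp[OF Quotient3_mmclass])
  then show ?thesis by (cases "rep_mmclass x") (simp add: mm_equiv_def)
qed

lemma mm_equiv_mm_class: 
  assumes "mm_space \<X>"
  shows "mm_equiv \<X> (rep_mmclass (mm_class \<X>))"
proof -
  define \<Y> :: "real mm" where "\<Y> = (SOME \<Y>. mm_equiv \<X> \<Y>)"
  have Y: "mm_equiv \<X> \<Y>"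
    unfolding \<Y>_def using ex_real_mm[OF assms] by (rule someI_ex)
  have "mm_equiv \<Y> \<Y>"
    by (rule mm_equiv_trans[OF mm_equiv_sym[OF Y] Y])
  then have "mm_equiv (rep_mmclass (mm_class \<X>)) \<Y>"
    unfolding mm_class_def \<Y>_def by (rule Quotient3_rep_abs[OF Quotient3_mmclass])
  from mm_equiv_trans[OF Y mm_equiv_sym[OF this]] show ?thesis .
qed

lemma mmclass_eqI: "mm_equiv (rep_mmclass x) (rep_mmclass y) \<Longrightarrow> x = y"
  by (simp add: Quotient3_rel_rep[OF Quotient3_mmclass])

definition class_laplace :: "real \<Rightarrow> mmclass \<Rightarrow> real" where
  "class_laplace l x = dist_laplace l (rep_mmclass x)"

lemma class_laplace_mm_class: "mm_space \<X> \<Longrightarrow> 0 \<le> l \<Longrightarrow> class_laplace l (mm_class \<X>) = dist_laplace l \<X>"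
  using dist_laplace_mm_equiv[OF mm_equiv_mm_class, symmetric] by (simp add: class_laplace_def)

lemma mmclass_rep_cases:
  obtains X \<mu> where "rep_mmclass x = (X, \<mu>)" "mm_space (X, \<mu>)" "metric_prob X \<mu>"
proof (cases "rep_mmclass x")
  case (Pair X \<mu>)
  with rep_mmclass_mm_space[of x] have "mm_space (X, \<mu>)" by simp
  with Pair show ?thesis by (intro that[of X \<mu>] metric_prob_mm_space)
qed

lemma class_laplace_plus: "0 \<le> l \<Longrightarrow> class_laplace l (x \<boxplus> y) = class_laplace l x * class_laplace l y"
proof -
  assume l: "0 \<le> l"
  obtain X \<mu> where x: "rep_mmclass x = (X, \<mu>)" "mm_space (X, \<mu>)" "metric_prob X \<mu>" by (rule mmclass_rep_cases)
  obtain Y \<nu> where y: "rep_mmclass y = (Y, \<nu>)" "mm_space (Y, \<nu>)" "metric_prob Y \<nu>" by (rule mmclass_rep_cases)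
  have "class_laplace l (x \<boxplus> y) = dist_laplace l (sum_metric X Y, \<mu> \<Otimes>\<^sub>M \<nu>)"
    using x y l by (simp add: mm_plus_def class_laplace_mm_class mm_space_sum)
  then show ?thesis using x y l by (simp add: dist_laplace_sum class_laplace_def)
qed

lemma class_laplace_scale: "0 \<le> l \<Longrightarrow> 0 < a \<Longrightarrow> class_laplace l (mm_scale a x) = class_laplace (l * a) x"
proof -
  assume l: "0 \<le> l" and a: "0 < a"
  obtain X \<mu> where x: "rep_mmclass x = (X, \<mu>)" "mm_space (X, \<mu>)" "metric_prob X \<mu>" by (rule mmclass_rep_cases)
  have "class_laplace l (mm_scale a x) = dist_laplace l (scale_metric a X, \<mu>)"
    using x l a by (simp add: mm_scale_def class_laplace_mm_class mm_space_scale)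
  then show ?thesis using x a by (simp add: dist_laplace_scale class_laplace_def)
qed

lemma class_laplace_partial_sum:
  "0 \<le> l \<Longrightarrow> 1 \<le> n \<Longrightarrow> class_laplace l (mm_partial_sum x n) = (\<Prod>i<n. class_laplace l (x i))"
proof (induction x n rule: mm_partial_sum.induct)
  case (3 x n)
  then show ?case by (simp add: class_laplace_plus)
qed auto

lemma class_laplace_bounds:
  assumes "0 \<le> l"
  shows "0 \<le> class_laplace l x" "class_laplace l x \<le> 1"
proof -
  obtain X \<mu> where x: "rep_mmclass x = (X, \<mu>)" "mm_space (X, \<mu>)" "metric_prob X \<mu>" by (rule mmclass_rep_cases)
  show "0 \<le> class_laplace l x" "class_laplace l x \<le> 1"
    using metric_prob.dist_laplace_bounds[OF x(3) assms] by (simp_all add: class_laplace_def x(1))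
qed

lemma class_laplace_le_convex:
  assumes "0 \<le> s" "s \<le> 1"
  shows "class_laplace s x \<le> 1 - s * (1 - class_laplace 1 x)"
proof -
  obtain X \<mu> where x: "rep_mmclass x = (X, \<mu>)" "mm_space (X, \<mu>)" "metric_prob X \<mu>" by (rule mmclass_rep_cases)
  show ?thesis
    using dist_laplace_le_convex[OF x(3) assms] by (simp add: class_laplace_def x(1))
qed

lemma class_laplace_less_one:
  assumes "x \<noteq> mm_point"
  shows "class_laplace 1 x < 1"
proof -
  obtain X \<mu> where x: "rep_mmclass x = (X, \<mu>)" "mm_space (X, \<mu>)" "metric_prob X \<mu>" by (rule mmclass_rep_cases)
  interpret metric_prob X \<mu> by (rule x)
  obtain p where p: "p \<in> mspace X" using not_empty space_eq by auto
  have "\<exists>q\<in>mspace X. q \<noteq> p"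
  proof (rule ccontr)
    assume "\<not> (\<exists>q\<in>mspace X. q \<noteq> p)"
    then have "mspace X \<subseteq> {p}" by auto
    with p have X: "mspace X = {p}" by (simp add: subset_singleton_iff) blast
    define E :: "unit metric" where "E = metric ({()}, \<lambda>_ _. 0)"
    have one: "mm_space (E, return (count_space {()}) ())"
      using mm_space_one_point[of "()"] by (simp add: one_point_mm_def E_def)
    have E: "mspace E = {()}" using mm_spaceD(4)[OF one] by simp
    have d0: "mdist E () () = 0" "mdist X p p = 0" using p by (simp_all add: E)
    have iso: "isometric_embedding X E (\<lambda>_. ())"
      unfolding isometric_embedding_def by (simp add: E X d0)
    have "(\<lambda>_. ()) ` mspace X = mspace E" by (simp add: E X)
    from mm_equiv_transport[OF x(2) iso this]
    have eq: "mm_equiv (X, \<mu>) (E, distr \<mu> (metric_borel E) (\<lambda>_. ()))" .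
    have "distr \<mu> (metric_borel E) (\<lambda>_. ()) = return (count_space {()}) ()"
    proof (rule measure_eqI)
      fix A assume "A \<in> sets (distr \<mu> (metric_borel E) (\<lambda>_. ()))"
      then have A: "A \<in> sets (metric_borel E)" by simp
      have "(\<lambda>_. ()) \<in> \<mu> \<rightarrow>\<^sub>M metric_borel E"
        by (rule measurable_const) (simp add: E)
      moreover have "A = {} \<or> A = {()}" using sets.sets_into_space[OF A] by (simp add: E subset_singleton_iff)
      ultimately show "emeasure (distr \<mu> (metric_borel E) (\<lambda>_. ())) A
          = emeasure (return (count_space {()}) ()) A"
        using A by (elim disjE) (simp_all add: emeasure_distr emeasure_space_1)
    qed (use mm_spaceD(5)[OF one] in simp)
    with eq have "mm_equiv (rep_mmclass x) (one_point_mm ())"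
      by (simp add: one_point_mm_def x E_def)
    then have "mm_equiv (rep_mmclass x) (rep_mmclass mm_point)"
      unfolding mm_point_def by (rule mm_equiv_trans[OF _ mm_equiv_mm_class[OF mm_space_one_point]])
    with assms show False using mmclass_eqI by blast
  qed
  with dist_laplace_less_one[OF x(2) p] show ?thesis by (auto simp: class_laplace_def x)
qed

section \<open>Continuity for the Gromov-Prohorov topology\<close>

text \<open>
  Extracting witnesses from the two nested infima requires that they range over nonempty sets, as
  \<open>Inf\<close> of the empty set of reals has no meaning. Both spaces embed into their sum, which has a
  real-carried copy, and \<open>\<epsilon> = 1\<close> is always admissible for probability measures.
\<close>

lemma gromov_prohorov_lessD:
  assumes less: "gromov_prohorov x y < \<delta>" and x: "rep_mmclass x = (X, \<mu>)" and y: "rep_mmclass y = (Y, \<nu>)"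
  obtains Z :: "real metric" and \<phi> \<psi> \<epsilon> where
    "isometric_embedding X Z \<phi>" "isometric_embedding Y Z \<psi>" "0 < \<epsilon>" "\<epsilon> < \<delta>"
    "\<forall>F. closedin (mtopology_of Z) F \<longrightarrow> measure (distr \<mu> (metric_borel Z) \<phi>) F
       \<le> measure (distr \<nu> (metric_borel Z) \<psi>) {z \<in> mspace Z. \<exists>w\<in>F. mdist Z z w < \<epsilon>} + \<epsilon>"
proof -
  have X: "mm_space (X, \<mu>)" and Y: "mm_space (Y, \<nu>)"
    using rep_mmclass_mm_space[of x] rep_mmclass_mm_space[of y] x y by simp_all
  interpret X: metric_prob X \<mu> by (rule metric_prob_mm_space[OF X])
  interpret Y: metric_prob Y \<nu> by (rule metric_prob_mm_space[OF Y])
  define S where "S = {prohorov_dist Z (distr \<mu> (metric_borel Z) \<phi>) (distr \<nu> (metric_borel Z) \<psi>)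
          | (Z :: real metric) \<phi> \<psi>. isometric_embedding X Z \<phi> \<and> isometric_embedding Y Z \<psi>}"
  have "S \<noteq> {}"
  proof -
    obtain p q where pq: "p \<in> mspace X" "q \<in> mspace Y"
      using X.not_empty X.space_eq Y.not_empty Y.space_eq by auto
    obtain Z :: "real metric" and f where f: "isometric_embedding (sum_metric X Y) Z f"
      using ex_real_mm[OF mm_space_sum[OF X Y]] by (auto simp: mm_equiv_def)
    have "isometric_embedding X Z (\<lambda>a. f (a, q))" "isometric_embedding Y Z (\<lambda>b. f (p, b))"
      using f pq by (auto simp: isometric_embedding_def Pi_iff)
    then show ?thesis unfolding S_def by blast
  qed
  moreover have "Inf S < \<delta>" using less by (simp add: gromov_prohorov_def x y S_def)
  ultimately obtain d where "d \<in> S" "d < \<delta>" using cInf_lessD by blast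
  then obtain Z :: "real metric" and \<phi> \<psi> where emb: "isometric_embedding X Z \<phi>" "isometric_embedding Y Z \<psi>"
    and d: "prohorov_dist Z (distr \<mu> (metric_borel Z) \<phi>) (distr \<nu> (metric_borel Z) \<psi>) < \<delta>"
    by (auto simp: S_def)
  define E where "E = {\<epsilon>. 0 < \<epsilon> \<and> (\<forall>F. closedin (mtopology_of Z) F \<longrightarrow>
        measure (distr \<mu> (metric_borel Z) \<phi>) F
       \<le> measure (distr \<nu> (metric_borel Z) \<psi>) {z \<in> mspace Z. \<exists>w\<in>F. mdist Z z w < \<epsilon>} + \<epsilon>)}"
  interpret D: metric_prob Z "distr \<mu> (metric_borel Z) \<phi>"
    by (rule dist_laplace_distr(1)[OF emb(1) X.metric_prob_axioms order_refl])
  have "1 \<in> E" unfolding E_def by (auto intro!: order_trans[OF D.prob_le_1])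
  moreover have "Inf E < \<delta>" using d by (simp add: prohorov_dist_def E_def)
  ultimately obtain \<epsilon> where "\<epsilon> \<in> E" "\<epsilon> < \<delta>" using cInf_lessD by blast
  then show ?thesis using that[OF emb, of \<epsilon>] by (auto simp: E_def)
qed

lemma class_laplace_lipschitz:
  assumes "gromov_prohorov x y < \<delta>" "0 \<le> l"
  shows "\<bar>class_laplace l x - class_laplace l y\<bar> \<le> 2 * (l + 1) * \<delta>"
proof -
  obtain X \<mu> where x: "rep_mmclass x = (X, \<mu>)" "mm_space (X, \<mu>)" "metric_prob X \<mu>" by (rule mmclass_rep_cases)
  obtain Y \<nu> where y: "rep_mmclass y = (Y, \<nu>)" "mm_space (Y, \<nu>)" "metric_prob Y \<nu>" by (rule mmclass_rep_cases)
  obtain Z :: "real metric" and \<phi> \<psi> \<epsilon> where emb: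
    "isometric_embedding X Z \<phi>" "isometric_embedding Y Z \<psi>" and \<epsilon>: "0 < \<epsilon>" "\<epsilon> < \<delta>" and PQ:
    "\<forall>F. closedin (mtopology_of Z) F \<longrightarrow> measure (distr \<mu> (metric_borel Z) \<phi>) F
       \<le> measure (distr \<nu> (metric_borel Z) \<psi>) {z \<in> mspace Z. \<exists>w\<in>F. mdist Z z w < \<epsilon>} + \<epsilon>"
    by (rule gromov_prohorov_lessD[OF assms(1) x(1) y(1)])
  note P = dist_laplace_distr[OF emb(1) x(3) assms(2)] and Q = dist_laplace_distr[OF emb(2) y(3) assms(2)]
  have "\<bar>class_laplace l x - class_laplace l y\<bar> \<le> 2 * (l + 1) * \<epsilon>"
    using dist_laplace_prohorov[OF P(1) Q(1) assms(2) _ PQ[rule_format]] \<epsilon>(1)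
    by (simp add: class_laplace_def x y P(2) Q(2))
  also have "\<dots> \<le> 2 * (l + 1) * \<delta>" using \<epsilon> assms by (intro mult_left_mono) auto
  finally show ?thesis .
qed

lemma continuous_class_laplace:
  assumes l: "0 \<le> l"
  shows "continuous_on UNIV (class_laplace l)"
  unfolding continuous_on_open_vimage[OF open_UNIV]
proof (intro allI impI)
  fix B :: "real set" assume B: "open B"
  show "open (class_laplace l -` B \<inter> UNIV)"
    unfolding open_mmclass_def
  proof (intro ballI)
    fix x assume "x \<in> class_laplace l -` B \<inter> UNIV"
    then obtain e where e: "0 < e" "\<And>t. dist t (class_laplace l x) < e \<Longrightarrow> t \<in> B"
      using B by (auto simp: open_dist)
    define \<delta> where "\<delta> = e / (4 * (l + 1))"
    have "0 < \<delta>" using e l by (simp add: \<delta>_def)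
    moreover have "y \<in> class_laplace l -` B \<inter> UNIV" if "gromov_prohorov x y < \<delta>" for y
    proof -
      have "\<bar>class_laplace l x - class_laplace l y\<bar> \<le> 2 * (l + 1) * \<delta>"
        by (rule class_laplace_lipschitz[OF that l])
      also have "\<dots> = e / 2" using l by (simp add: \<delta>_def field_simps)
      also have "\<dots> < e" using e by simp
      finally show ?thesis using e(2) by (simp add: dist_real_def abs_minus_commute)
    qed
    ultimately show "\<exists>\<epsilon>>0. \<forall>y. gromov_prohorov x y < \<epsilon> \<longrightarrow> y \<in> class_laplace l -` B \<inter> UNIV"
      by blast
  qed
qed

section \<open>No normalized sum converges in distribution\<close>

theorem mainTheorem6:
  fixes M :: "'w measure" and X :: "nat \<Rightarrow> 'w \<Rightarrow> mmclass" and r :: "nat \<Rightarrow> nat"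
  assumes "prob_space M"
    and indep: "prob_space.indep_vars M (\<lambda>_. borel) X UNIV"
    and ident: "\<And>k. distr M borel (X k) = distr M borel (X 0)"
    and nontrivial: "\<And>k. \<not> (AE \<omega> in M. X k \<omega> = mm_point)"
    and subseq: "strict_mono r" "\<And>j. 1 \<le> r j"
  shows "\<not> (\<exists>\<nu>. converges_in_distribution M
    (\<lambda>j \<omega>. mm_scale (1 / real (r j)) (mm_partial_sum (\<lambda>k. X k \<omega>) (r j))) \<nu>)"
proof
  assume "\<exists>\<nu>. converges_in_distribution M
    (\<lambda>j \<omega>. mm_scale (1 / real (r j)) (mm_partial_sum (\<lambda>k. X k \<omega>) (r j))) \<nu>"
  then obtain \<nu> where \<nu>: "prob_space \<nu>" "sets \<nu> = sets borel" and
    lim: "\<And>f::mmclass \<Rightarrow> real. continuous_on UNIV f \<Longrightarrow> bounded (range f) \<Longrightarrow>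
        (\<lambda>j. \<integral>\<omega>. f (mm_scale (1 / real (r j)) (mm_partial_sum (\<lambda>k. X k \<omega>) (r j))) \<partial>M) \<longlonglongrightarrow> (\<integral>x. f x \<partial>\<nu>)"
    unfolding converges_in_distribution_def by blast
  interpret prob_space M by fact
  interpret \<nu>: prob_space \<nu> by fact
  have meas: "class_laplace l \<in> borel_measurable borel" if "0 \<le> l" for l
    by (rule borel_measurable_continuous_onI[OF continuous_class_laplace[OF that]])
  have X [measurable]: "X k \<in> M \<rightarrow>\<^sub>M borel" for k
    using indep by (simp add: indep_vars_def)
  define g where "g l = (\<integral>\<omega>. class_laplace l (X 0 \<omega>) \<partial>M)" for l
  have g: "(\<integral>\<omega>. class_laplace l (X k \<omega>) \<partial>M) = g l" if "0 \<le> l" for l k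
    unfolding g_def
    using integral_distr[OF X[of k] meas[OF that]] integral_distr[OF X[of 0] meas[OF that]] ident[of k]
    by simp
  have int: "integrable M (\<lambda>\<omega>. class_laplace l (X k \<omega>))" if "0 \<le> l" for l k
    using class_laplace_bounds[OF that] measurable_compose[OF X[of k] meas[OF that]]
    by (intro integrable_const_bound[of _ 1]) auto
  define c where "c = 1 - g 1"
  have c: "0 < c"
  proof (rule ccontr)
    assume "\<not> 0 < c"
    then have "(\<integral>\<omega>. 1 - class_laplace 1 (X 0 \<omega>) \<partial>M) \<le> 0"
      using int[of 1 0] by (simp add: c_def g_def prob_space)
    moreover have "0 \<le> (\<integral>\<omega>. 1 - class_laplace 1 (X 0 \<omega>) \<partial>M)"
      using class_laplace_bounds(2)[of 1] by (intro Bochner_Integration.integral_nonneg_AE) auto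
    ultimately have "(\<integral>\<omega>. 1 - class_laplace 1 (X 0 \<omega>) \<partial>M) = 0" by simp
    then have "AE \<omega> in M. 1 - class_laplace 1 (X 0 \<omega>) = 0"
      using int[of 1 0] class_laplace_bounds(2)[of 1]
      by (subst (asm) integral_nonneg_eq_0_iff_AE) auto
    then have "AE \<omega> in M. X 0 \<omega> = mm_point"
      by eventually_elim (use class_laplace_less_one in force)
    with nontrivial show False by blast
  qed
  have g_le: "g s \<le> exp (- (c * s))" if s: "0 \<le> s" "s \<le> 1" for s
  proof -
    have "g s \<le> (\<integral>\<omega>. 1 - s * (1 - class_laplace 1 (X 0 \<omega>)) \<partial>M)"
      unfolding g_def using s int class_laplace_le_convex by (intro integral_mono) auto
    also have "\<dots> = 1 + (- (c * s))" using int[of 1 0] by (simp add: g_def c_def prob_space algebra_simps)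
    also have "\<dots> \<le> exp (- (c * s))" by (rule exp_ge_add_one_self)
    finally show ?thesis .
  qed
  have g_nonneg: "0 \<le> g l" if "0 \<le> l" for l
    unfolding g_def using class_laplace_bounds(1)[OF that] by simp
  have mean: "(\<integral>\<omega>. class_laplace l (mm_scale (1 / real (r j)) (mm_partial_sum (\<lambda>k. X k \<omega>) (r j))) \<partial>M)
      = g (l / r j) ^ r j" if l: "0 \<le> l" for l j
  proof -
    have r: "1 \<le> r j" by (rule subseq(2))
    have l': "0 \<le> l / r j" using l by simp
    have "indep_vars (\<lambda>_. borel) (\<lambda>i \<omega>. class_laplace (l / r j) (X i \<omega>)) {..<r j}"
      by (rule indep_vars_compose2[OF indep_vars_subset[OF indep]]) (use meas[OF l'] in auto)
    then have "(\<integral>\<omega>. (\<Prod>i<r j. class_laplace (l / r j) (X i \<omega>)) \<partial>M)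
        = (\<Prod>i<r j. \<integral>\<omega>. class_laplace (l / r j) (X i \<omega>) \<partial>M)"
      by (intro indep_vars_lebesgue_integral) (use int[OF l'] in auto)
    also have "\<dots> = g (l / r j) ^ r j" by (simp add: g[OF l'])
    finally show ?thesis
      using r l l' by (simp add: class_laplace_scale class_laplace_partial_sum)
  qed
  \<comment> \<open>The base \<open>g (n / r j)\<close> is only controlled for arguments at most 1, hence for \<open>r j \<ge> n\<close>.\<close>
  have limit_le: "(\<integral>x. class_laplace n x \<partial>\<nu>) \<le> exp (- (c * n))" for n :: nat
  proof (rule LIMSEQ_le_const2)
    have "bounded (range (class_laplace n))"
      using class_laplace_bounds[of n] by (auto simp: bounded_iff intro!: exI[of _ 1])
    from lim[OF continuous_class_laplace this]
    show "(\<lambda>j. g (n / r j) ^ r j) \<longlonglongrightarrow> (\<integral>x. class_laplace n x \<partial>\<nu>)" by (simp add: mean)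
    show "\<exists>N. \<forall>j\<ge>N. g (n / r j) ^ r j \<le> exp (- (c * n))"
    proof (intro exI allI impI)
      fix j assume "n \<le> j"
      then have r: "n \<le> r j" "1 \<le> r j"
        using seq_suble[OF subseq(1), of j] subseq(2)[of j] by auto
      have "g (n / r j) ^ r j \<le> exp (- (c * (n / r j))) ^ r j"
        using r by (intro power_mono g_le g_nonneg) auto
      also have "\<dots> = exp (- (c * n))" using r by (simp flip: exp_of_nat_mult)
      finally show "g (n / r j) ^ r j \<le> exp (- (c * n))" .
    qed
  qed
  \<comment> \<open>The rate \<open>b\<close> lies strictly between 0 and \<open>c\<close>: it beats the subexponential decay at each point,
      but not the decay of the mean. The truncation at 1 provides the dominating function.\<close>
  define b where "b = c / 2"
  have b: "0 < b" "c = b + b" using c by (auto simp: b_def)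
  define h where "h n x = min 1 (exp (b * n) * class_laplace n x)" for n :: nat and x
  have meas_h: "h n \<in> borel_measurable \<nu>" for n
    using meas[of n] \<nu>(2) unfolding h_def[abs_def] by (auto cong: measurable_cong_sets)
  have int_\<nu>: "integrable \<nu> (class_laplace n)" for n :: nat
    using class_laplace_bounds[of n] meas[of n] \<nu>(2)
    by (intro \<nu>.integrable_const_bound[of _ 1]) (auto cong: measurable_cong_sets)
  have int_h: "integrable \<nu> (h n)" for n
    using meas_h class_laplace_bounds(1)[of n]
    by (intro \<nu>.integrable_const_bound[of _ 1]) (auto simp: h_def)
  have "(\<lambda>n. \<integral>x. h n x \<partial>\<nu>) \<longlonglongrightarrow> (\<integral>x. 1 \<partial>\<nu>)"
  proof (rule integral_dominated_convergence[where w = "\<lambda>_. 1"])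
    show "AE x in \<nu>. (\<lambda>n. h n x) \<longlonglongrightarrow> 1"
    proof (rule AE_I2)
      fix x
      obtain Y \<mu> where x: "rep_mmclass x = (Y, \<mu>)" "mm_space (Y, \<mu>)" "metric_prob Y \<mu>" by (rule mmclass_rep_cases)
      obtain \<kappa> where \<kappa>: "0 < \<kappa>" "\<And>l. 0 \<le> l \<Longrightarrow> \<kappa> * exp (- (l * (b / 2))) \<le> class_laplace l x"
        using dist_laplace_lower[OF x(2), of "b / 2"] b by (auto simp: class_laplace_def x)
      have "filterlim (\<lambda>n::nat. exp (b / 2 * n) * \<kappa>) at_top sequentially"
        using b \<kappa>(1) by real_asymp
      then have "eventually (\<lambda>n::nat. 1 \<le> exp (b / 2 * n) * \<kappa>) sequentially"
        by (simp add: filterlim_at_top)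
      then have "eventually (\<lambda>n. h n x = 1) sequentially"
      proof eventually_elim
        fix n :: nat assume "1 \<le> exp (b / 2 * n) * \<kappa>"
        also have "\<dots> = exp (b * n) * (\<kappa> * exp (- (n * (b / 2))))"
          by (simp add: field_simps flip: exp_add)
        also have "\<dots> \<le> exp (b * n) * class_laplace n x" by (intro mult_left_mono \<kappa>) auto
        finally show "h n x = 1" by (simp add: h_def)
      qed
      then show "(\<lambda>n. h n x) \<longlonglongrightarrow> 1" by (rule tendsto_eventually)
    qed
    show "AE x in \<nu>. norm (h n x) \<le> 1" for n
      using class_laplace_bounds(1)[of n] by (auto simp: h_def)
  qed (use meas_h in auto)
  then have "(\<lambda>n. \<integral>x. h n x \<partial>\<nu>) \<longlonglongrightarrow> 1" by (simp add: \<nu>.prob_space)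
  moreover have "(\<lambda>n. \<integral>x. h n x \<partial>\<nu>) \<longlonglongrightarrow> 0"
  proof (rule tendsto_sandwich[OF _ _ tendsto_const])
    show "(\<lambda>n::nat. exp (- (b * n))) \<longlonglongrightarrow> 0" using b by real_asymp
    show "eventually (\<lambda>n. 0 \<le> (\<integral>x. h n x \<partial>\<nu>)) sequentially"
      using class_laplace_bounds(1) by (intro always_eventually allI Bochner_Integration.integral_nonneg_AE) (auto simp: h_def)
    show "eventually (\<lambda>n. (\<integral>x. h n x \<partial>\<nu>) \<le> exp (- (b * real n))) sequentially"
    proof (intro always_eventually allI)
      fix n
      have "(\<integral>x. h n x \<partial>\<nu>) \<le> (\<integral>x. exp (b * n) * class_laplace n x \<partial>\<nu>)"
        using int_h int_\<nu> by (intro integral_mono) (auto simp: h_def)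
      also have "\<dots> \<le> exp (b * n) * exp (- (c * n))"
        using limit_le[of n] by simp
      also have "\<dots> = exp (- (b * n))" by (simp add: b(2) algebra_simps flip: exp_add)
      finally show "(\<integral>x. h n x \<partial>\<nu>) \<le> exp (- (b * real n))" .
    qed
  qed
  ultimately show False using LIMSEQ_unique by fastforce
qed

end
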